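(* Let $A$ be a Banach algebra with a central bounded approximate identity $(e_\lambda)_{\lambda\in\Lambda}$. Suppose that $A$ has a multiplier-bounded approximate diagonal $(M_i)$. Then the forced unitization $A^\#$ has a multiplier-bounded approximate diagonal, and so $A$ is boundedly approximately contractible.
   Context: A central bounded approximate identity is a norm-bounded net $(e_\lambda)$ in the centre of $A$ with $e_\lambda a\to a$ in norm for all $a\in A$. $A^\#$ denotes the forced unitization of $A$ (an identity is adjoined even if $A$ already has one). For a Banach algebra $B$, $\pi:B\widehat\otimes B\to B$ is the bounded linear map with $\pi(a\otimes b)=ab$, where $\widehat\otimes$ is the projective tensor product, and $B\widehat\otimes B$ is a $B$-bimodule via $c(a\otimes b)=ca\otimes b$, $(a\otimes b)c=a\otimes bc$. An approximate diagonal for $B$ is a net $(M_i)$ in $B\widehat\otimes B$ such that $aM_i-M_ia\to0$ and $a\pi(M_i)\to a$ for each $a\in B$. It is multiplier-bounded if there is a constant $K$ such that $\|aM_i-M_ia\|$, $\|a\pi(M_i)-a\|$ and $\|\pi(M_i)a-a\|$ are all at most $K\|a\|$, for all $a\in B$ and all $i$. A Banach algebra $A$ is boundedly approximately contractible if for every Banach $A$-bimodule $X$ and every continuous derivation $D:A\to X$ there is a net $(D_i)$ of inner derivations $A\to X$, bounded in operator norm, with $D_i(a)\to D(a)$ in norm for all $a\in A$. *)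

theory Defs
  imports "HOL-Analysis.Analysis" "HOL-Library.Multiset"
begin

section \<open>Complex Banach algebras\<close>

class complex_vector = ab_group_add +
  fixes scaleC :: "complex \<Rightarrow> 'a \<Rightarrow> 'a"  (infixr "*\<^sub>C" 75)
  assumes scaleC_add_right: "c *\<^sub>C (x + y) = c *\<^sub>C x + c *\<^sub>C y"
    and scaleC_add_left: "(c + d) *\<^sub>C x = c *\<^sub>C x + d *\<^sub>C x"
    and scaleC_scaleC: "c *\<^sub>C d *\<^sub>C x = (c * d) *\<^sub>C x"
    and scaleC_one: "1 *\<^sub>C x = x"
begin

lemma scaleC_zero_left [simp]: "0 *\<^sub>C x = 0"
  using scaleC_add_left[of 0 0 x] by simp

lemma scaleC_zero_right [simp]: "c *\<^sub>C 0 = 0"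
  using scaleC_add_right[of c 0 0] by simp

lemma scaleC_minus_left: "(- c) *\<^sub>C x = - (c *\<^sub>C x)"
  using scaleC_add_left[of "- c" c x] by (simp add: eq_neg_iff_add_eq_0)

lemma scaleC_minus_right: "c *\<^sub>C (- x) = - (c *\<^sub>C x)"
  using scaleC_add_right[of c "- x" x] by (simp add: eq_neg_iff_add_eq_0)

end

class complex_normed_vector = complex_vector + real_normed_vector +
  assumes scaleR_scaleC: "r *\<^sub>R x = complex_of_real r *\<^sub>C x"
    and norm_scaleC: "norm (c *\<^sub>C x) = norm c * norm x"

class complex_banach = complex_normed_vector + banach

text \<open>No identity is required; \<^class>\<open>real_normed_algebra\<close> contributes the bilinearity over the
  reals and the submultiplicativity of the norm.\<close>

class complex_banach_algebra = complex_banach + real_normed_algebra +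
  assumes mult_scaleC_left: "(c *\<^sub>C x) * y = c *\<^sub>C (x * y)"
    and mult_scaleC_right: "x * (c *\<^sub>C y) = c *\<^sub>C (x * y)"

instantiation complex :: complex_banach_algebra
begin
definition scaleC_complex :: "complex \<Rightarrow> complex \<Rightarrow> complex" where "scaleC_complex c x = c * x"
instance
  by standard (simp_all add: scaleC_complex_def algebra_simps norm_mult scaleR_conv_of_real)
end

definition bounded_clinear :: "('a::complex_normed_vector \<Rightarrow> 'b::complex_normed_vector) \<Rightarrow> bool" where
  "bounded_clinear f \<longleftrightarrow> bounded_linear f \<and> (\<forall>c x. f (c *\<^sub>C x) = c *\<^sub>C f x)"

definition bounded_cbilinear ::
  "('a::complex_normed_vector \<Rightarrow> 'b::complex_normed_vector \<Rightarrow> 'c::complex_normed_vector) \<Rightarrow> bool" where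
  "bounded_cbilinear f \<longleftrightarrow> bounded_bilinear f \<and>
     (\<forall>c x y. f (c *\<^sub>C x) y = c *\<^sub>C f x y \<and> f x (c *\<^sub>C y) = c *\<^sub>C f x y)"


section \<open>Nets\<close>

definition directed_set :: "'i set \<Rightarrow> ('i \<times> 'i) set \<Rightarrow> bool" where
  "directed_set I r \<longleftrightarrow> I \<noteq> {} \<and> preorder_on I r \<and>
     (\<forall>i\<in>I. \<forall>j\<in>I. \<exists>k\<in>I. (i, k) \<in> r \<and> (j, k) \<in> r)"

text \<open>The filter of tails: \<open>(f \<longlongrightarrow> l) (net_filter I r)\<close> is convergence of the net
  \<open>(f i)\<^sub>i\<close> indexed by \<open>(I, r)\<close>.\<close>

definition net_filter :: "'i set \<Rightarrow> ('i \<times> 'i) set \<Rightarrow> 'i filter" where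
  "net_filter I r = (INF i\<in>I. principal {j. (i, j) \<in> r})"

lemma eventually_net_filter:
  assumes "directed_set I r"
  shows "eventually P (net_filter I r) \<longleftrightarrow> (\<exists>i\<in>I. \<forall>j. (i, j) \<in> r \<longrightarrow> P j)"
proof -
  have "eventually P (net_filter I r) \<longleftrightarrow> (\<exists>i\<in>I. eventually P (principal {j. (i, j) \<in> r}))"
    unfolding net_filter_def
  proof (rule eventually_INF_base)
    show "I \<noteq> {}" using assms by (simp add: directed_set_def)
    fix a b assume "a \<in> I" "b \<in> I"
    then obtain k where "k \<in> I" "(a, k) \<in> r" "(b, k) \<in> r"
      using assms unfolding directed_set_def by blast
    moreover have "trans r" using assms by (simp add: directed_set_def preorder_on_def)
    ultimately show "\<exists>x\<in>I. principal {j. (x, j) \<in> r}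
        \<le> inf (principal {j. (a, j) \<in> r}) (principal {j. (b, j) \<in> r})"
      by (intro bexI[of _ k]) (auto dest: transD)
  qed
  then show ?thesis by (simp add: eventually_principal)
qed

text \<open>Existence of a net cannot quantify over the type of its indices. The net \<open>(S, x) \<mapsto> x\<close> over
  pairs \<open>x \<in> S\<close> with \<open>S\<close> in the filter generated by the tails of a given net loses nothing, so
  nets in \<open>'t\<close> may be indexed by a subset of \<open>'t set \<times> 't\<close>.\<close>

type_synonym 't net_index = "'t set \<times> 't"

lemma net_reindex:
  fixes f :: "'i \<Rightarrow> 't"
  assumes "directed_set I r"
  shows "\<exists>(J :: 't net_index set) s. directed_set J s \<and> snd ` J \<subseteq> f ` I \<and>
           filtermap snd (net_filter J s) = filtermap f (net_filter I r)"
proof -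
  define S where "S i = f ` {j. (i, j) \<in> r}" for i
  define J where "J = {(S i, x) | i x. i \<in> I \<and> x \<in> S i}"
  define s where "s = {(p, q). p \<in> J \<and> q \<in> J \<and> fst q \<subseteq> fst p}"
  have rI: "r \<subseteq> I \<times> I" and rr: "\<And>i. i \<in> I \<Longrightarrow> (i, i) \<in> r" and rt: "trans r" and ne: "I \<noteq> {}"
    and up: "\<And>i j. i \<in> I \<Longrightarrow> j \<in> I \<Longrightarrow> \<exists>k\<in>I. (i, k) \<in> r \<and> (j, k) \<in> r"
    using assms unfolding directed_set_def preorder_on_def refl_on_def by auto
  have Sin: "f i \<in> S i" if "i \<in> I" for i using rr[OF that] by (auto simp: S_def)
  have Smono: "S k \<subseteq> S i" if "(i, k) \<in> r" for i k
    using rt that unfolding S_def by (auto dest: transD)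
  have dir: "directed_set J s"
    unfolding directed_set_def
  proof (intro conjI ballI)
    show "J \<noteq> {}" using ne Sin unfolding J_def by blast
    show "preorder_on J s"
      unfolding preorder_on_def refl_on_def s_def by (auto intro: transI)
    fix p q assume "p \<in> J" "q \<in> J"
    then obtain i j where ij: "i \<in> I" "fst p = S i" "j \<in> I" "fst q = S j"
      unfolding J_def by auto
    obtain k where k: "k \<in> I" "(i, k) \<in> r" "(j, k) \<in> r" using up ij by blast
    show "\<exists>k\<in>J. (p, k) \<in> s \<and> (q, k) \<in> s"
      using k ij Sin Smono \<open>p \<in> J\<close> \<open>q \<in> J\<close>
      by (intro bexI[of _ "(S k, f k)"]) (auto simp: s_def J_def)
  qed
  have "filtermap snd (net_filter J s) = filtermap f (net_filter I r)"
  proof (rule filter_eqI)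
    fix P
    have "(\<exists>p\<in>J. \<forall>q. (p, q) \<in> s \<longrightarrow> P (snd q)) \<longleftrightarrow> (\<exists>i\<in>I. \<forall>j. (i, j) \<in> r \<longrightarrow> P (f j))"
    proof
      assume "\<exists>p\<in>J. \<forall>q. (p, q) \<in> s \<longrightarrow> P (snd q)"
      then obtain p where p: "p \<in> J" and P: "\<And>q. (p, q) \<in> s \<Longrightarrow> P (snd q)" by blast
      from p obtain i where i: "i \<in> I" "fst p = S i" unfolding J_def by auto
      have "P (f j)" if "(i, j) \<in> r" for j
      proof -
        have "f j \<in> S i" using that by (auto simp: S_def)
        then have "(p, (S i, f j)) \<in> s" using p i by (auto simp: s_def J_def)
        from P[OF this] show ?thesis by simp
      qed
      then show "\<exists>i\<in>I. \<forall>j. (i, j) \<in> r \<longrightarrow> P (f j)" using i by blast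
    next
      assume "\<exists>i\<in>I. \<forall>j. (i, j) \<in> r \<longrightarrow> P (f j)"
      then obtain i where i: "i \<in> I" and P: "\<And>j. (i, j) \<in> r \<Longrightarrow> P (f j)" by blast
      have "P (snd q)" if "((S i, f i), q) \<in> s" for q
      proof -
        have "snd q \<in> S i" using that by (auto simp: s_def J_def)
        then show ?thesis using P by (auto simp: S_def)
      qed
      then show "\<exists>p\<in>J. \<forall>q. (p, q) \<in> s \<longrightarrow> P (snd q)"
        using i Sin by (intro bexI[of _ "(S i, f i)"]) (auto simp: J_def)
    qed
    then show "eventually P (filtermap snd (net_filter J s)) \<longleftrightarrow>
        eventually P (filtermap f (net_filter I r))"
      by (simp add: eventually_filtermap eventually_net_filter[OF dir] eventually_net_filter[OF assms])
  qed
  moreover have "snd ` J \<subseteq> f ` I" using rI unfolding J_def S_def by auto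
  ultimately show ?thesis using dir by blast
qed


section \<open>The algebraic tensor product and the projective norm\<close>

text \<open>A multiset of pairs stands for the formal sum \<open>\<Sum>\<^sub>k a\<^sub>k \<otimes> b\<^sub>k\<close>; scalars are absorbed
  into the first factor.\<close>

inductive tensor_eq ::
  "('a::complex_vector \<times> 'b::complex_vector) multiset \<Rightarrow> ('a \<times> 'b) multiset \<Rightarrow> bool" where
  refl: "tensor_eq u u"
| sym: "tensor_eq u v \<Longrightarrow> tensor_eq v u"
| trans: "tensor_eq u v \<Longrightarrow> tensor_eq v w \<Longrightarrow> tensor_eq u w"
| add: "tensor_eq u v \<Longrightarrow> tensor_eq (u + w) (v + w)"
| zero: "tensor_eq {#(0, b)#} {#}"
| add_left: "tensor_eq {#(a + a', b)#} {#(a, b), (a', b)#}"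
| add_right: "tensor_eq {#(a, b + b')#} {#(a, b), (a, b')#}"
| scale: "tensor_eq {#(c *\<^sub>C a, b)#} {#(a, c *\<^sub>C b)#}"

lemma tensor_eq_add2: "tensor_eq u v \<Longrightarrow> tensor_eq u' v' \<Longrightarrow> tensor_eq (u + u') (v + v')"
proof -
  assume uv: "tensor_eq u v" and uv': "tensor_eq u' v'"
  have "tensor_eq (v + u') (v + v')" using tensor_eq.add[OF uv', of v] by (simp add: add.commute)
  with tensor_eq.add[OF uv, of u'] show ?thesis by (rule tensor_eq.trans)
qed

quotient_type (overloaded) ('a, 'b) atensor =
  "('a::complex_vector \<times> 'b::complex_vector) multiset" / tensor_eq
  by (intro equivpI reflpI sympI transpI) (fact tensor_eq.refl tensor_eq.sym tensor_eq.trans)+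

lemma tensor_eq_image_left:
  assumes add: "\<And>x y. g (x + y) = g x + g y" and sc: "\<And>c x. g (c *\<^sub>C x) = c *\<^sub>C g x"
    and eq: "tensor_eq u v"
  shows "tensor_eq (image_mset (\<lambda>(a, b). (g a, b)) u) (image_mset (\<lambda>(a, b). (g a, b)) v)"
proof -
  have g0: "g 0 = 0" using add[of 0 0] by simp
  from eq show ?thesis
  proof induction
    case (sym u v) from sym.IH show ?case by (rule tensor_eq.sym)
  next
    case (trans u v w) from trans.IH show ?case by (rule tensor_eq.trans)
  next
    case (add u v w) then show ?case by (simp add: tensor_eq.add)
  qed (simp_all add: assms(1) sc g0 tensor_eq.refl tensor_eq.zero tensor_eq.add_left
      tensor_eq.add_right tensor_eq.scale)
qed

instantiation atensor :: (complex_vector, complex_vector) complex_vector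
begin

lift_definition zero_atensor :: "('a, 'b) atensor" is "{#}" .

lift_definition plus_atensor :: "('a, 'b) atensor \<Rightarrow> ('a, 'b) atensor \<Rightarrow> ('a, 'b) atensor" is "(+)"
  by (rule tensor_eq_add2)

lift_definition scaleC_atensor :: "complex \<Rightarrow> ('a, 'b) atensor \<Rightarrow> ('a, 'b) atensor"
  is "\<lambda>c. image_mset (\<lambda>(a, b). (c *\<^sub>C a, b))"
  by (rule tensor_eq_image_left) (simp_all add: scaleC_add_right scaleC_scaleC mult.commute)

lift_definition uminus_atensor :: "('a, 'b) atensor \<Rightarrow> ('a, 'b) atensor"
  is "image_mset (\<lambda>(a, b). (- a, b))"
  by (rule tensor_eq_image_left) (simp_all add: scaleC_minus_right)

definition minus_atensor :: "('a, 'b) atensor \<Rightarrow> ('a, 'b) atensor \<Rightarrow> ('a, 'b) atensor"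
  where "minus_atensor s t = s + (- t)"

instance
proof
  fix s t u :: "('a, 'b) atensor" and c d :: complex
  show "s + t + u = s + (t + u)" by transfer (simp add: add.assoc tensor_eq.refl)
  show "s + t = t + s" by transfer (simp add: add.commute tensor_eq.refl)
  show "0 + s = s" by transfer (simp add: tensor_eq.refl)
  show "- s + s = 0"
  proof (transfer)
    fix w :: "('a \<times> 'b) multiset"
    show "tensor_eq (image_mset (\<lambda>(a, b). (- a, b)) w + w) {#}"
    proof (induction w)
      case (add x w)
      obtain a b where x: "x = (a, b)" by (cases x)
      have "tensor_eq {#(- a + a, b)#} {#}" by (simp add: tensor_eq.zero)
      then have "tensor_eq {#(- a, b), (a, b)#} {#}"
        by (rule tensor_eq.trans[OF tensor_eq.sym[OF tensor_eq.add_left]])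
      from tensor_eq_add2[OF this add.IH] show ?case by (simp add: x add_mset_commute)
    qed (simp add: tensor_eq.refl)
  qed
  show "s - t = s + - t" by (fact minus_atensor_def)
  show "c *\<^sub>C (s + t) = c *\<^sub>C s + c *\<^sub>C t" by transfer (simp add: tensor_eq.refl)
  show "(c + d) *\<^sub>C s = c *\<^sub>C s + d *\<^sub>C s"
  proof (transfer fixing: c d)
    fix w :: "('a \<times> 'b) multiset"
    show "tensor_eq (image_mset (\<lambda>(a, b). ((c + d) *\<^sub>C a, b)) w)
        (image_mset (\<lambda>(a, b). (c *\<^sub>C a, b)) w + image_mset (\<lambda>(a, b). (d *\<^sub>C a, b)) w)"
    proof (induction w)
      case (add x w)
      obtain a b where x: "x = (a, b)" by (cases x)
      have "tensor_eq {#((c + d) *\<^sub>C a, b)#} {#(c *\<^sub>C a, b), (d *\<^sub>C a, b)#}"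
        using tensor_eq.add_left[of "c *\<^sub>C a" "d *\<^sub>C a" b] by (simp add: scaleC_add_left)
      from tensor_eq_add2[OF this add.IH] show ?case
        by (simp add: x add_mset_commute)
    qed (simp add: tensor_eq.refl)
  qed
  show "c *\<^sub>C d *\<^sub>C s = (c * d) *\<^sub>C s"
    by transfer (simp add: multiset.map_comp o_def case_prod_unfold scaleC_scaleC tensor_eq.refl)
  show "1 *\<^sub>C s = s" by transfer (simp add: scaleC_one tensor_eq.refl)
qed

end

text \<open>\<open>abs_atensor u = t\<close> says that \<open>u\<close> represents \<open>t\<close>.\<close>

definition proj_norm :: "('a::complex_normed_vector, 'b::complex_normed_vector) atensor \<Rightarrow> real" where
  "proj_norm t = Inf {(\<Sum>(a, b)\<in>#u. norm a * norm b) | u. abs_atensor u = t}"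

lemma abs_atensor_exhaust: obtains u where "abs_atensor u = t"
  by (metis Quotient3_abs_rep Quotient3_atensor)

lemma abs_atensor_simps:
  "abs_atensor (u + v) = abs_atensor u + abs_atensor v"
  "abs_atensor {#} = 0"
  "c *\<^sub>C abs_atensor u = abs_atensor (image_mset (\<lambda>(a, b). (c *\<^sub>C a, b)) u)"
  by (simp_all add: plus_atensor.abs_eq zero_atensor_def scaleC_atensor.abs_eq)

lemma rep_sum_nonneg: "0 \<le> (\<Sum>(a, b)\<in>#u. norm a * norm b)"
  for u :: "('a::real_normed_vector \<times> 'b::real_normed_vector) multiset"
  by (induction u) auto

lemma proj_norm_le: "proj_norm (abs_atensor u) \<le> (\<Sum>(a, b)\<in>#u. norm a * norm b)"
  unfolding proj_norm_def by (rule cInf_lower) (auto intro!: bdd_belowI[of _ 0] rep_sum_nonneg)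

lemma proj_norm_less:
  assumes "proj_norm t < e"
  obtains u where "abs_atensor u = t" "(\<Sum>(a, b)\<in>#u. norm a * norm b) < e"
proof -
  have "{(\<Sum>(a, b)\<in>#u. norm a * norm b) | u. abs_atensor u = t} \<noteq> {}"
    using abs_atensor_exhaust by blast
  from cInf_lessD[OF this assms[unfolded proj_norm_def]] that show thesis by blast
qed

lemma proj_norm_nonneg [simp]: "0 \<le> proj_norm t"
  unfolding proj_norm_def
proof (rule cInf_greatest)
  show "{(\<Sum>(a, b)\<in>#u. norm a * norm b) | u. abs_atensor u = t} \<noteq> {}"
    using abs_atensor_exhaust by blast
qed (auto intro: rep_sum_nonneg)

lemma proj_norm_zero [simp]: "proj_norm 0 = 0"
proof (rule antisym)
  show "proj_norm (0 :: ('a, 'b) atensor) \<le> 0"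
    using proj_norm_le[of "{#} :: ('a \<times> 'b) multiset"] by (simp add: abs_atensor_simps)
qed simp

lemma proj_norm_triangle: "proj_norm (s + t) \<le> proj_norm s + proj_norm t"
proof (rule field_le_epsilon)
  fix e :: real assume "0 < e"
  then have "proj_norm s < proj_norm s + e / 2" "proj_norm t < proj_norm t + e / 2" by auto
  then obtain u v where u: "abs_atensor u = s" "(\<Sum>(a, b)\<in>#u. norm a * norm b) < proj_norm s + e / 2"
    and v: "abs_atensor v = t" "(\<Sum>(a, b)\<in>#v. norm a * norm b) < proj_norm t + e / 2"
    by (metis proj_norm_less)
  have "proj_norm (s + t) \<le> (\<Sum>(a, b)\<in>#u + v. norm a * norm b)"
    using proj_norm_le[of "u + v"] by (simp add: abs_atensor_simps u v)
  then show "proj_norm (s + t) \<le> proj_norm s + proj_norm t + e"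
    using u v by simp
qed

lemma proj_norm_scaleC_le: "proj_norm (c *\<^sub>C t) \<le> norm c * proj_norm t"
proof (rule field_le_epsilon)
  fix e :: real assume "0 < e"
  then have "proj_norm t < proj_norm t + e / (norm c + 1)" by (simp add: add_nonneg_pos)
  then obtain u where u: "abs_atensor u = t"
      "(\<Sum>(a, b)\<in>#u. norm a * norm b) < proj_norm t + e / (norm c + 1)"
    by (rule proj_norm_less)
  have "proj_norm (c *\<^sub>C t) \<le>
      (\<Sum>(a, b)\<in>#image_mset (\<lambda>(a, b). (c *\<^sub>C a, b)) u. norm a * norm b)"
    using proj_norm_le by (simp add: abs_atensor_simps flip: u(1))
  also have "\<dots> = (\<Sum>(a, b)\<in>#u. norm c * (norm a * norm b))"
    by (simp add: multiset.map_comp o_def case_prod_unfold norm_scaleC mult.assoc)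
  also have "\<dots> = norm c * (\<Sum>(a, b)\<in>#u. norm a * norm b)"
    by (simp add: sum_mset_distrib_left case_prod_unfold)
  also have "\<dots> \<le> norm c * (proj_norm t + e / (norm c + 1))"
    using u by (intro mult_left_mono) auto
  also have "\<dots> \<le> norm c * proj_norm t + e"
  proof -
    have "norm c * (e / (norm c + 1)) \<le> (norm c + 1) * (e / (norm c + 1))"
      using \<open>0 < e\<close> by (intro mult_right_mono) auto
    also have "\<dots> = e"
      using norm_ge_zero[of c] by (smt (verit) nonzero_mult_div_cancel_left times_divide_eq_right)
    finally show ?thesis by (simp add: distrib_left)
  qed
  finally show "proj_norm (c *\<^sub>C t) \<le> norm c * proj_norm t + e" .
qed

lemma proj_norm_scaleC: "proj_norm (c *\<^sub>C t) = norm c * proj_norm t"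
proof (cases "c = 0")
  case False
  have "norm c * proj_norm t = norm c * proj_norm (inverse c *\<^sub>C c *\<^sub>C t)"
    using False by (simp add: scaleC_scaleC scaleC_one)
  also have "\<dots> \<le> norm c * (norm (inverse c) * proj_norm (c *\<^sub>C t))"
    by (intro mult_left_mono proj_norm_scaleC_le) auto
  also have "\<dots> = proj_norm (c *\<^sub>C t)"
    using False by (simp add: norm_inverse)
  finally show ?thesis using proj_norm_scaleC_le[of c t] by simp
qed simp

lemma proj_norm_minus [simp]: "proj_norm (- t) = proj_norm t"
  using proj_norm_scaleC[of "-1" t] by (simp add: scaleC_minus_left scaleC_one)

lemma proj_norm_minus_commute: "proj_norm (s - t) = proj_norm (t - s)"
  using proj_norm_minus[of "s - t"] by simp

lemma proj_norm_diff: "\<bar>proj_norm s - proj_norm t\<bar> \<le> proj_norm (s - t)"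
  using proj_norm_triangle[of "s - t" t] proj_norm_triangle[of "t - s" s]
    proj_norm_minus_commute[of s t] by simp

lemma proj_norm_diff_triangle: "proj_norm (s - u) \<le> proj_norm (s - t) + proj_norm (t - u)"
  using proj_norm_triangle[of "s - t" "t - u"] by simp


section \<open>The projective tensor product\<close>

definition proj_Cauchy ::
  "(nat \<Rightarrow> ('a::complex_normed_vector, 'b::complex_normed_vector) atensor) \<Rightarrow> bool" where
  "proj_Cauchy S \<longleftrightarrow> (\<forall>e>0. \<exists>N. \<forall>m\<ge>N. \<forall>n\<ge>N. proj_norm (S m - S n) < e)"

text \<open>Completion of the algebraic tensor product as Cauchy sequences modulo null sequences. That
  \<open>proj_norm\<close> is definite is not needed for this construction.\<close>

definition cauchy_rel ::
  "(nat \<Rightarrow> ('a::complex_normed_vector, 'b::complex_normed_vector) atensor) \<Rightarrow>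
   (nat \<Rightarrow> ('a, 'b) atensor) \<Rightarrow> bool" where
  "cauchy_rel S T \<longleftrightarrow> proj_Cauchy S \<and> proj_Cauchy T \<and> (\<lambda>n. proj_norm (S n - T n)) \<longlonglongrightarrow> 0"

lemma proj_Cauchy_const: "proj_Cauchy (\<lambda>n. t)"
  by (simp add: proj_Cauchy_def)

lemma null_le:
  fixes f g :: "nat \<Rightarrow> real"
  shows "g \<longlonglongrightarrow> 0 \<Longrightarrow> (\<And>n. 0 \<le> f n) \<Longrightarrow> (\<And>n. f n \<le> g n) \<Longrightarrow> f \<longlonglongrightarrow> 0"
  by (rule tendsto_sandwich[of "\<lambda>_. 0" f sequentially g]) auto

quotient_type (overloaded) ('a, 'b) ptensor =
  "nat \<Rightarrow> ('a::complex_normed_vector, 'b::complex_normed_vector) atensor" / partial: cauchy_rel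
proof (rule part_equivpI)
  show "\<exists>S::nat \<Rightarrow> ('a, 'b) atensor. cauchy_rel S S"
    by (intro exI[of _ "\<lambda>n. 0"]) (simp add: cauchy_rel_def proj_Cauchy_const)
  show "symp (cauchy_rel :: (nat \<Rightarrow> ('a, 'b) atensor) \<Rightarrow> _)"
    by (rule sympI) (simp add: cauchy_rel_def proj_norm_minus_commute)
  show "transp (cauchy_rel :: (nat \<Rightarrow> ('a, 'b) atensor) \<Rightarrow> _)"
  proof (rule transpI)
    fix S T U :: "nat \<Rightarrow> ('a, 'b) atensor"
    assume 1: "cauchy_rel S T" and 2: "cauchy_rel T U"
    then have "(\<lambda>n. proj_norm (S n - T n) + proj_norm (T n - U n)) \<longlonglongrightarrow> 0"
      unfolding cauchy_rel_def by (intro tendsto_add_zero) auto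
    then have "(\<lambda>n. proj_norm (S n - U n)) \<longlonglongrightarrow> 0"
      by (rule null_le) (auto intro: proj_norm_diff_triangle)
    then show "cauchy_rel S U" using 1 2 by (simp add: cauchy_rel_def)
  qed
qed

lemma proj_Cauchy_add:
  assumes "proj_Cauchy S" "proj_Cauchy T"
  shows "proj_Cauchy (\<lambda>n. S n + T n)"
  unfolding proj_Cauchy_def
proof (intro allI impI)
  fix e :: real assume "0 < e"
  then have e: "0 < e / 2" by simp
  obtain M where M: "\<And>m n. m \<ge> M \<Longrightarrow> n \<ge> M \<Longrightarrow> proj_norm (S m - S n) < e / 2"
    using assms(1) e unfolding proj_Cauchy_def by blast
  obtain N where N: "\<And>m n. m \<ge> N \<Longrightarrow> n \<ge> N \<Longrightarrow> proj_norm (T m - T n) < e / 2"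
    using assms(2) e unfolding proj_Cauchy_def by blast
  have "proj_norm (S m + T m - (S n + T n)) < e" if "m \<ge> max M N" "n \<ge> max M N" for m n
    using proj_norm_triangle[of "S m - S n" "T m - T n"] M[of m n] N[of m n] that
    by (simp add: algebra_simps)
  then show "\<exists>N. \<forall>m\<ge>N. \<forall>n\<ge>N. proj_norm (S m + T m - (S n + T n)) < e" by blast
qed

lemma scaleC_diff_right: "c *\<^sub>C (x - y) = c *\<^sub>C x - c *\<^sub>C (y :: 'a::complex_vector)"
  using scaleC_add_right[of c x "- y"] by (simp add: scaleC_minus_right)

lemma proj_Cauchy_scaleC:
  assumes "proj_Cauchy S"
  shows "proj_Cauchy (\<lambda>n. c *\<^sub>C S n)"
  unfolding proj_Cauchy_def
proof (intro allI impI)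
  fix e :: real assume "0 < e"
  then have "0 < e / (norm c + 1)" by (simp add: add_nonneg_pos)
  then obtain N where N: "\<And>m n. m \<ge> N \<Longrightarrow> n \<ge> N \<Longrightarrow> proj_norm (S m - S n) < e / (norm c + 1)"
    using assms unfolding proj_Cauchy_def by blast
  have "proj_norm (c *\<^sub>C S m - c *\<^sub>C S n) < e" if "m \<ge> N" "n \<ge> N" for m n
  proof -
    have "proj_norm (c *\<^sub>C S m - c *\<^sub>C S n) = norm c * proj_norm (S m - S n)"
      by (simp add: proj_norm_scaleC flip: scaleC_diff_right)
    also have "\<dots> \<le> (norm c + 1) * proj_norm (S m - S n)" by (simp add: algebra_simps)
    also have "\<dots> < e" using N[OF that] by (simp add: pos_less_divide_eq add_nonneg_pos mult.commute)
    finally show ?thesis .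
  qed
  then show "\<exists>N. \<forall>m\<ge>N. \<forall>n\<ge>N. proj_norm (c *\<^sub>C S m - c *\<^sub>C S n) < e" by blast
qed

lemma proj_Cauchy_norm_Cauchy:
  assumes "proj_Cauchy S"
  shows "Cauchy (\<lambda>n. proj_norm (S n))"
proof (rule CauchyI)
  fix e :: real assume "0 < e"
  then obtain N where N: "\<And>m n. m \<ge> N \<Longrightarrow> n \<ge> N \<Longrightarrow> proj_norm (S m - S n) < e"
    using assms unfolding proj_Cauchy_def by blast
  then show "\<exists>N. \<forall>m\<ge>N. \<forall>n\<ge>N. norm (proj_norm (S m) - proj_norm (S n)) < e"
    by (intro exI[of _ N]) (auto intro: order.strict_trans1[OF proj_norm_diff])
qed

lemma proj_Cauchy_norm_lim:
  "proj_Cauchy S \<Longrightarrow> (\<lambda>n. proj_norm (S n)) \<longlonglongrightarrow> lim (\<lambda>n. proj_norm (S n))"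
  by (rule convergent_LIMSEQ_iff[THEN iffD1, OF Cauchy_convergent[OF proj_Cauchy_norm_Cauchy]])

instantiation ptensor :: (complex_normed_vector, complex_normed_vector) complex_normed_vector
begin

lift_definition zero_ptensor :: "('a, 'b) ptensor" is "\<lambda>n. 0"
  by (simp add: cauchy_rel_def proj_Cauchy_const)

lift_definition plus_ptensor :: "('a, 'b) ptensor \<Rightarrow> ('a, 'b) ptensor \<Rightarrow> ('a, 'b) ptensor"
  is "\<lambda>S T n. S n + T n"
proof -
  fix S S' T T' :: "nat \<Rightarrow> ('a, 'b) atensor"
  assume 1: "cauchy_rel S S'" and 2: "cauchy_rel T T'"
  then have "(\<lambda>n. proj_norm (S n - S' n) + proj_norm (T n - T' n)) \<longlonglongrightarrow> 0"
    unfolding cauchy_rel_def by (intro tendsto_add_zero) auto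
  then have "(\<lambda>n. proj_norm (S n + T n - (S' n + T' n))) \<longlonglongrightarrow> 0"
    by (rule null_le) (auto simp: add_diff_add intro: proj_norm_triangle)
  then show "cauchy_rel (\<lambda>n. S n + T n) (\<lambda>n. S' n + T' n)"
    using 1 2 by (simp add: cauchy_rel_def proj_Cauchy_add)
qed

lift_definition scaleC_ptensor :: "complex \<Rightarrow> ('a, 'b) ptensor \<Rightarrow> ('a, 'b) ptensor"
  is "\<lambda>c S n. c *\<^sub>C S n"
proof -
  fix c :: complex and S T :: "nat \<Rightarrow> ('a, 'b) atensor"
  assume 1: "cauchy_rel S T"
  then have "(\<lambda>n. norm c * proj_norm (S n - T n)) \<longlonglongrightarrow> norm c * 0"
    unfolding cauchy_rel_def by (intro tendsto_mult) auto
  then show "cauchy_rel (\<lambda>n. c *\<^sub>C S n) (\<lambda>n. c *\<^sub>C T n)"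
    using 1 by (simp add: cauchy_rel_def proj_Cauchy_scaleC proj_norm_scaleC flip: scaleC_diff_right)
qed

lift_definition norm_ptensor :: "('a, 'b) ptensor \<Rightarrow> real" is "\<lambda>S. lim (\<lambda>n. proj_norm (S n))"
proof -
  fix S T :: "nat \<Rightarrow> ('a, 'b) atensor"
  assume 1: "cauchy_rel S T"
  then have "(\<lambda>n. proj_norm (S n - T n)) \<longlonglongrightarrow> 0" by (simp add: cauchy_rel_def)
  then have "(\<lambda>n. proj_norm (S n) - proj_norm (T n)) \<longlonglongrightarrow> 0"
    by (rule Lim_null_comparison[OF always_eventually, rotated]) (simp add: proj_norm_diff)
  moreover have "(\<lambda>n. proj_norm (S n) - proj_norm (T n)) \<longlonglongrightarrow>
      lim (\<lambda>n. proj_norm (S n)) - lim (\<lambda>n. proj_norm (T n))"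
    using 1 by (intro tendsto_diff proj_Cauchy_norm_lim) (simp_all add: cauchy_rel_def)
  ultimately have "0 = lim (\<lambda>n. proj_norm (S n)) - lim (\<lambda>n. proj_norm (T n))"
    by (rule LIMSEQ_unique)
  then show "lim (\<lambda>n. proj_norm (S n)) = lim (\<lambda>n. proj_norm (T n))" by simp
qed

definition uminus_ptensor :: "('a, 'b) ptensor \<Rightarrow> ('a, 'b) ptensor"
  where "uminus_ptensor x = (- 1) *\<^sub>C x"

definition minus_ptensor :: "('a, 'b) ptensor \<Rightarrow> ('a, 'b) ptensor \<Rightarrow> ('a, 'b) ptensor"
  where "minus_ptensor x y = x + (- y)"

definition scaleR_ptensor :: "real \<Rightarrow> ('a, 'b) ptensor \<Rightarrow> ('a, 'b) ptensor"
  where "scaleR_ptensor r x = complex_of_real r *\<^sub>C x"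

definition sgn_ptensor :: "('a, 'b) ptensor \<Rightarrow> ('a, 'b) ptensor"
  where "sgn_ptensor x = inverse (norm x) *\<^sub>R x"

definition dist_ptensor :: "('a, 'b) ptensor \<Rightarrow> ('a, 'b) ptensor \<Rightarrow> real"
  where "dist_ptensor x y = norm (x - y)"

definition uniformity_ptensor :: "(('a, 'b) ptensor \<times> ('a, 'b) ptensor) filter"
  where "uniformity_ptensor = (INF e\<in>{0 <..}. principal {(x, y). dist x y < e})"

definition open_ptensor :: "('a, 'b) ptensor set \<Rightarrow> bool"
  where "open_ptensor U \<longleftrightarrow> (\<forall>x\<in>U. eventually (\<lambda>(x', y). x' = x \<longrightarrow> y \<in> U) uniformity)"

instance
proof
  have D: "proj_Cauchy S" if "cauchy_rel S S" for S :: "nat \<Rightarrow> ('a, 'b) atensor"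
    using that by (simp add: cauchy_rel_def)
  note C = proj_Cauchy_add proj_Cauchy_scaleC
  fix x y z :: "('a, 'b) ptensor" and c d :: complex and r r' :: real
  show assoc: "x + y + z = x + (y + z)"
    by transfer (simp add: add.assoc cauchy_rel_def C)
  show comm: "x + y = y + x"
    by transfer (simp add: add.commute cauchy_rel_def C)
  show zero: "0 + x = x"
    by transfer (simp add: cauchy_rel_def C)
  show addr: "c *\<^sub>C (x + y) = c *\<^sub>C x + c *\<^sub>C y" for c and x y :: "('a, 'b) ptensor"
    by transfer (simp add: scaleC_add_right cauchy_rel_def C)
  show addl: "(c + d) *\<^sub>C x = c *\<^sub>C x + d *\<^sub>C x" for c d and x :: "('a, 'b) ptensor"
    by transfer (simp add: scaleC_add_left cauchy_rel_def C)
  show scsc: "c *\<^sub>C d *\<^sub>C x = (c * d) *\<^sub>C x" for c d and x :: "('a, 'b) ptensor"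
    by transfer (simp add: scaleC_scaleC cauchy_rel_def C)
  show one: "1 *\<^sub>C x = x" for x :: "('a, 'b) ptensor"
    by transfer (simp add: scaleC_one cauchy_rel_def C)
  have "0 *\<^sub>C x = 0" by transfer (simp add: cauchy_rel_def proj_Cauchy_const)
  then show "- x + x = 0"
    using addl[of "- 1" 1 x] one[of x] by (simp add: uminus_ptensor_def)
  show "x - y = x + - y" by (fact minus_ptensor_def)
  show "r *\<^sub>R x = complex_of_real r *\<^sub>C x" by (fact scaleR_ptensor_def)
  show "r *\<^sub>R (x + y) = r *\<^sub>R x + r *\<^sub>R y" by (simp add: scaleR_ptensor_def addr)
  show "(r + r') *\<^sub>R x = r *\<^sub>R x + r' *\<^sub>R x" by (simp add: scaleR_ptensor_def addl)
  show "r *\<^sub>R r' *\<^sub>R x = (r * r') *\<^sub>R x" by (simp add: scaleR_ptensor_def scsc)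
  show "1 *\<^sub>R x = x" by (simp add: scaleR_ptensor_def one)
  show "sgn x = inverse (norm x) *\<^sub>R x" by (fact sgn_ptensor_def)
  show "dist x y = norm (x - y)" by (fact dist_ptensor_def)
  show "(uniformity :: (('a, 'b) ptensor \<times> ('a, 'b) ptensor) filter) =
      (INF e\<in>{0 <..}. principal {(x, y). dist x y < e})"
    by (fact uniformity_ptensor_def)
  show "open U \<longleftrightarrow> (\<forall>x\<in>U. eventually (\<lambda>(x', y). x' = x \<longrightarrow> y \<in> U) uniformity)"
    for U :: "('a, 'b) ptensor set"
    by (fact open_ptensor_def)
  show "norm x = 0 \<longleftrightarrow> x = 0"
  proof transfer
    fix S :: "nat \<Rightarrow> ('a, 'b) atensor" assume S: "cauchy_rel S S"
    have "lim (\<lambda>n. proj_norm (S n)) = 0 \<longleftrightarrow> (\<lambda>n. proj_norm (S n)) \<longlonglongrightarrow> 0"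
      using proj_Cauchy_norm_lim[OF D[OF S]] by (auto intro: limI)
    then show "lim (\<lambda>n. proj_norm (S n)) = 0 \<longleftrightarrow> cauchy_rel S (\<lambda>n. 0)"
      using D[OF S] by (simp add: cauchy_rel_def proj_Cauchy_const)
  qed
  show "norm (x + y) \<le> norm x + norm y"
  proof transfer
    fix S T :: "nat \<Rightarrow> ('a, 'b) atensor" assume S: "cauchy_rel S S" and T: "cauchy_rel T T"
    show "lim (\<lambda>n. proj_norm (S n + T n)) \<le> lim (\<lambda>n. proj_norm (S n)) + lim (\<lambda>n. proj_norm (T n))"
      by (rule LIMSEQ_le[OF proj_Cauchy_norm_lim[OF proj_Cauchy_add[OF D[OF S] D[OF T]]]
            tendsto_add[OF proj_Cauchy_norm_lim[OF D[OF S]] proj_Cauchy_norm_lim[OF D[OF T]]]])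
        (simp add: proj_norm_triangle)
  qed
  show nsc: "norm (c *\<^sub>C x) = norm c * norm x" for c
  proof transfer
    fix c :: complex and S :: "nat \<Rightarrow> ('a, 'b) atensor" assume S: "cauchy_rel S S"
    show "lim (\<lambda>n. proj_norm (c *\<^sub>C S n)) = norm c * lim (\<lambda>n. proj_norm (S n))"
      unfolding proj_norm_scaleC
      by (rule limI[OF tendsto_mult[OF tendsto_const proj_Cauchy_norm_lim[OF D[OF S]]]])
  qed
  show "norm (r *\<^sub>R x) = \<bar>r\<bar> * norm x"
    by (simp add: scaleR_ptensor_def nsc)
qed

end

definition of_atensor ::
  "('a::complex_normed_vector, 'b::complex_normed_vector) atensor \<Rightarrow> ('a, 'b) ptensor" where
  "of_atensor t = abs_ptensor (\<lambda>n. t)"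

lemma cauchy_rel_refl: "proj_Cauchy S \<Longrightarrow> cauchy_rel S S"
  by (simp add: cauchy_rel_def)

lemma of_atensor_add: "of_atensor (s + t) = of_atensor s + of_atensor t"
  by (simp add: of_atensor_def plus_ptensor.abs_eq cauchy_rel_refl proj_Cauchy_const)

lemma of_atensor_scaleC: "of_atensor (c *\<^sub>C t) = c *\<^sub>C of_atensor t"
  by (simp add: of_atensor_def scaleC_ptensor.abs_eq cauchy_rel_refl proj_Cauchy_const)

lemma of_atensor_zero [simp]: "of_atensor 0 = 0"
  by (simp add: of_atensor_def zero_ptensor_def)

lemma of_atensor_diff: "of_atensor (s - t) = of_atensor s - of_atensor t"
  using of_atensor_add[of "s - t" t] by simp

lemma norm_of_atensor: "norm (of_atensor t) = proj_norm t"
  by (simp add: of_atensor_def norm_ptensor.abs_eq cauchy_rel_refl proj_Cauchy_const)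

lemma of_atensor_dense:
  assumes "0 < e"
  shows "\<exists>t. norm (x - of_atensor t) < e"
proof -
  define S where "S = rep_ptensor x"
  have S: "cauchy_rel S S" unfolding S_def by (rule Quotient3_rep_reflp[OF Quotient3_ptensor])
  have x: "x = abs_ptensor S" unfolding S_def by (rule Quotient3_abs_rep[OF Quotient3_ptensor, symmetric])
  have "proj_Cauchy S" using S by (simp add: cauchy_rel_def)
  with half_gt_zero[OF assms] obtain N where
    N: "\<And>m n. m \<ge> N \<Longrightarrow> n \<ge> N \<Longrightarrow> proj_norm (S m - S n) < e / 2"
    unfolding proj_Cauchy_def by blast
  have CN: "proj_Cauchy (\<lambda>n. S n - S N)"
    using S proj_Cauchy_add[of S "\<lambda>n. - S N"] by (simp add: cauchy_rel_def proj_Cauchy_const)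
  have "of_atensor (S N) = abs_ptensor (\<lambda>n. S N)" by (simp add: of_atensor_def)
  moreover have "x - of_atensor (S N) = abs_ptensor (\<lambda>n. S n - S N)"
  proof -
    have "abs_ptensor (\<lambda>n. S n - S N) + of_atensor (S N) = abs_ptensor (\<lambda>n. S n - S N + S N)"
      unfolding calculation
      by (rule plus_ptensor.abs_eq) (simp_all add: cauchy_rel_def CN proj_Cauchy_const)
    then show ?thesis by (simp add: x algebra_simps)
  qed
  ultimately have "norm (x - of_atensor (S N)) = lim (\<lambda>n. proj_norm (S n - S N))"
    using norm_ptensor.abs_eq[of "\<lambda>n. S n - S N"] CN by (simp add: cauchy_rel_def)
  also have "\<dots> \<le> e / 2"
  proof (rule LIMSEQ_le_const2[OF proj_Cauchy_norm_lim[OF CN]])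
    show "\<exists>M. \<forall>n\<ge>M. proj_norm (S n - S N) \<le> e / 2"
      by (intro exI[of _ N] allI impI, rule less_imp_le, rule N) simp_all
  qed
  finally show ?thesis using assms by (intro exI[of _ "S N"]) auto
qed

instance ptensor :: (complex_normed_vector, complex_normed_vector) complex_banach
proof
  fix X :: "nat \<Rightarrow> ('a, 'b) ptensor"
  assume X: "Cauchy X"
  have "\<forall>n. \<exists>t. norm (X n - of_atensor t) < inverse (real (Suc n))"
    by (intro allI of_atensor_dense) simp
  then obtain T where T: "\<And>n. norm (X n - of_atensor (T n)) < inverse (real (Suc n))" by metis
  have XT: "(\<lambda>n. X n - of_atensor (T n)) \<longlonglongrightarrow> 0"
    by (rule Lim_null_comparison[OF _ LIMSEQ_inverse_real_of_nat])
      (intro always_eventually allI less_imp_le T)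
  have "Cauchy (\<lambda>n. of_atensor (T n))"
  proof (rule CauchyI)
    fix e :: real assume "0 < e"
    then have e: "0 < e / 3" by simp
    obtain M where M: "\<And>m n. m \<ge> M \<Longrightarrow> n \<ge> M \<Longrightarrow> norm (X m - X n) < e / 3"
      using CauchyD[OF X e] by blast
    obtain N where N: "\<And>n. n \<ge> N \<Longrightarrow> norm (X n - of_atensor (T n)) < e / 3"
      using LIMSEQ_D[OF XT e] by auto
    have "norm (of_atensor (T m) - of_atensor (T n)) < e" if "m \<ge> max M N" "n \<ge> max M N" for m n
    proof -
      have "of_atensor (T m) - of_atensor (T n) =
          (X m - X n) - (X m - of_atensor (T m)) + (X n - of_atensor (T n))" by simp
      also have "norm \<dots> \<le> norm (X m - X n) + norm (X m - of_atensor (T m))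
          + norm (X n - of_atensor (T n))"
        by (rule order_trans[OF norm_triangle_ineq add_right_mono[OF norm_triangle_ineq4]])
      also have "\<dots> < e" using M[of m n] N[of m] N[of n] that by simp
      finally show ?thesis .
    qed
    then show "\<exists>N. \<forall>m\<ge>N. \<forall>n\<ge>N. norm (of_atensor (T m) - of_atensor (T n)) < e"
      by blast
  qed
  then have CT: "proj_Cauchy T"
    by (simp add: Cauchy_iff proj_Cauchy_def norm_of_atensor flip: of_atensor_diff)
  have rT: "cauchy_rel T T" using CT by (simp add: cauchy_rel_def)
  define y where "y = abs_ptensor T"
  have nrm: "norm (of_atensor (T m) - y) = lim (\<lambda>n. proj_norm (T m - T n))" for m
  proof -
    have C: "proj_Cauchy (\<lambda>n. T m - T n)"
      using proj_Cauchy_add[OF proj_Cauchy_const[of "T m"] proj_Cauchy_scaleC[OF CT, of "-1"]]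
      by (simp add: scaleC_minus_left scaleC_one)
    have "abs_ptensor (\<lambda>n. T m - T n) + y = abs_ptensor (\<lambda>n. T m - T n + T n)"
      unfolding y_def by (rule plus_ptensor.abs_eq) (simp_all add: cauchy_rel_def C CT)
    also have "\<dots> = of_atensor (T m)" by (simp add: of_atensor_def)
    finally have "of_atensor (T m) - y = abs_ptensor (\<lambda>n. T m - T n)" by (simp add: algebra_simps)
    then show ?thesis using norm_ptensor.abs_eq[of "\<lambda>n. T m - T n"] C by (simp add: cauchy_rel_def)
  qed
  have "(\<lambda>n. of_atensor (T n)) \<longlonglongrightarrow> y"
  proof (rule LIMSEQ_I)
    fix e :: real assume "0 < e"
    then have "0 < e / 2" by simp
    with CT obtain N where N: "\<And>m n. m \<ge> N \<Longrightarrow> n \<ge> N \<Longrightarrow> proj_norm (T m - T n) < e / 2"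
      unfolding proj_Cauchy_def by blast
    have "norm (of_atensor (T m) - y) < e" if m: "m \<ge> N" for m
    proof -
      have C: "proj_Cauchy (\<lambda>n. T m - T n)"
        using proj_Cauchy_add[OF proj_Cauchy_const[of "T m"] proj_Cauchy_scaleC[OF CT, of "-1"]]
        by (simp add: scaleC_minus_left scaleC_one)
      have "lim (\<lambda>n. proj_norm (T m - T n)) \<le> e / 2"
      proof (rule LIMSEQ_le_const2[OF proj_Cauchy_norm_lim[OF C]])
        show "\<exists>M. \<forall>n\<ge>M. proj_norm (T m - T n) \<le> e / 2"
          by (intro exI[of _ N] allI impI, rule less_imp_le, rule N) (simp_all add: m)
      qed
      then show ?thesis using \<open>0 < e\<close> by (simp add: nrm)
    qed
    then show "\<exists>no. \<forall>n\<ge>no. norm (of_atensor (T n) - y) < e" by blast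
  qed
  from tendsto_add[OF XT this] have "X \<longlonglongrightarrow> y" by simp
  then show "convergent X" by (rule convergentI)
qed

definition tensor ::
  "'a::complex_normed_vector \<Rightarrow> 'b::complex_normed_vector \<Rightarrow> ('a, 'b) ptensor"  (infixl "\<otimes>\<^sub>\<pi>" 72)
  where "a \<otimes>\<^sub>\<pi> b = of_atensor (abs_atensor {#(a, b)#})"

lemma bounded_cbilinear_tensor: "bounded_cbilinear (\<otimes>\<^sub>\<pi>)"
proof -
  have al: "(a + a') \<otimes>\<^sub>\<pi> b = a \<otimes>\<^sub>\<pi> b + a' \<otimes>\<^sub>\<pi> b" for a a' :: 'a and b :: 'b
  proof -
    have "abs_atensor {#(a + a', b)#} = abs_atensor {#(a, b)#} + abs_atensor {#(a', b)#}"
      using tensor_eq.add_left[of a a' b]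
      by (simp add: plus_atensor.abs_eq atensor.abs_eq_iff add_mset_commute)
    then show ?thesis by (simp add: tensor_def of_atensor_add)
  qed
  have ar: "a \<otimes>\<^sub>\<pi> (b + b') = a \<otimes>\<^sub>\<pi> b + a \<otimes>\<^sub>\<pi> b'" for a :: 'a and b b' :: 'b
  proof -
    have "abs_atensor {#(a, b + b')#} = abs_atensor {#(a, b)#} + abs_atensor {#(a, b')#}"
      using tensor_eq.add_right[of a b b']
      by (simp add: plus_atensor.abs_eq atensor.abs_eq_iff add_mset_commute)
    then show ?thesis by (simp add: tensor_def of_atensor_add)
  qed
  have sl: "(c *\<^sub>C a) \<otimes>\<^sub>\<pi> b = c *\<^sub>C (a \<otimes>\<^sub>\<pi> b)" for c and a :: 'a and b :: 'b
    by (simp add: tensor_def abs_atensor_simps flip: of_atensor_scaleC)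
  have sr: "a \<otimes>\<^sub>\<pi> (c *\<^sub>C b) = c *\<^sub>C (a \<otimes>\<^sub>\<pi> b)" for c and a :: 'a and b :: 'b
  proof -
    have "abs_atensor {#(c *\<^sub>C a, b)#} = abs_atensor {#(a, c *\<^sub>C b)#}"
      by (simp add: atensor.abs_eq_iff tensor_eq.scale)
    then show ?thesis unfolding sl[symmetric] by (simp add: tensor_def)
  qed
  have "norm (a \<otimes>\<^sub>\<pi> b) \<le> norm a * norm b * 1" for a :: 'a and b :: 'b
    using proj_norm_le[of "{#(a, b)#}"] by (simp add: tensor_def norm_of_atensor)
  then have "bounded_bilinear ((\<otimes>\<^sub>\<pi>) :: 'a \<Rightarrow> 'b \<Rightarrow> _)"
    by (intro bounded_bilinear.intro exI[of _ 1] allI) (auto simp: al ar sl sr scaleR_scaleC)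
  then show ?thesis by (auto simp: bounded_cbilinear_def sl sr)
qed

lemma of_atensor_abs: "of_atensor (abs_atensor u) = (\<Sum>(a, b)\<in>#u. a \<otimes>\<^sub>\<pi> b)"
proof (induction u)
  case (add x u)
  obtain a b where x: "x = (a, b)" by (cases x)
  have "abs_atensor (add_mset x u) = abs_atensor {#(a, b)#} + abs_atensor u"
    by (simp add: x plus_atensor.abs_eq)
  then show ?case using add by (simp add: x of_atensor_add tensor_def)
qed (simp add: abs_atensor_simps)

lemma bounded_clinear_ptensor_eqI:
  fixes T U :: "('a::complex_normed_vector, 'b::complex_normed_vector) ptensor \<Rightarrow> 'c::complex_normed_vector"
  assumes T: "bounded_clinear T" and U: "bounded_clinear U"
    and eq: "\<And>a b. T (a \<otimes>\<^sub>\<pi> b) = U (a \<otimes>\<^sub>\<pi> b)"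
  shows "T = U"
proof
  fix x
  interpret T: bounded_linear T using T unfolding bounded_clinear_def by (rule conjunct1)
  interpret U: bounded_linear U using U unfolding bounded_clinear_def by (rule conjunct1)
  have sums: "T (\<Sum>(a, b)\<in>#u. a \<otimes>\<^sub>\<pi> b) = U (\<Sum>(a, b)\<in>#u. a \<otimes>\<^sub>\<pi> b)" for u
    by (induction u) (auto simp: T.add U.add T.zero U.zero eq)
  have on_alg: "T (of_atensor t) = U (of_atensor t)" for t
  proof -
    obtain u where "abs_atensor u = t" by (rule abs_atensor_exhaust)
    then show ?thesis using sums[of u] by (simp flip: of_atensor_abs)
  qed
  have "\<forall>n. \<exists>t :: ('a, 'b) atensor. norm (x - of_atensor t) < inverse (real (Suc n))"
    by (intro allI of_atensor_dense) simp
  then obtain t :: "nat \<Rightarrow> ('a, 'b) atensor" where t: "\<And>n. norm (x - of_atensor (t n)) < inverse (real (Suc n))" by metis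
  have "(\<lambda>n. x - of_atensor (t n)) \<longlonglongrightarrow> 0"
    by (rule Lim_null_comparison[OF _ LIMSEQ_inverse_real_of_nat])
      (intro always_eventually allI less_imp_le t)
  from tendsto_diff[OF tendsto_const[of x] this] have lim: "(\<lambda>n. of_atensor (t n)) \<longlonglongrightarrow> x"
    by simp
  have "(\<lambda>n. T (of_atensor (t n))) \<longlonglongrightarrow> U x"
    unfolding on_alg by (rule U.tendsto[OF lim])
  then show "T x = U x" by (rule LIMSEQ_unique[OF T.tendsto[OF lim]])
qed

lemma ptensor_lift_exists:
  fixes f :: "'a::complex_normed_vector \<Rightarrow> 'b::complex_normed_vector \<Rightarrow> 'c::complex_banach"
  assumes f: "bounded_cbilinear f"
    and K: "0 < K" "\<And>a b. norm (f a b) \<le> norm a * norm b * K"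
  shows "\<exists>T. bounded_clinear T \<and> (\<forall>a b. T (a \<otimes>\<^sub>\<pi> b) = f a b) \<and> (\<forall>x. norm (T x) \<le> norm x * K)"
proof -
  interpret f: bounded_bilinear f using f unfolding bounded_cbilinear_def by (rule conjunct1)
  have fl: "f (c *\<^sub>C a) b = c *\<^sub>C f a b" and fr: "f a (c *\<^sub>C b) = c *\<^sub>C f a b" for c a b
    using f by (auto simp: bounded_cbilinear_def)
  define g where "g u = (\<Sum>(a, b)\<in>#u. f a b)" for u
  have g_eq: "g u = g v" if "tensor_eq u v" for u v
    using that by induction (simp_all add: g_def f.zero_left f.add_left f.add_right fl fr)
  define A where "A t = g (rep_atensor t)" for t
  have A_abs: "A (abs_atensor u) = g u" for u
    unfolding A_def by (rule g_eq) (rule Quotient3_rep_abs[OF Quotient3_atensor, OF tensor_eq.refl])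
  have A_add: "A (s + t) = A s + A t" for s t
  proof -
    obtain u v where "abs_atensor u = s" "abs_atensor v = t" using abs_atensor_exhaust by metis
    then show ?thesis using A_abs[of "u + v"] A_abs[of u] A_abs[of v]
      by (simp add: abs_atensor_simps g_def)
  qed
  have A_scale: "A (c *\<^sub>C t) = c *\<^sub>C A t" for c t
  proof -
    obtain u where u: "abs_atensor u = t" using abs_atensor_exhaust by metis
    have "g (image_mset (\<lambda>(a, b). (c *\<^sub>C a, b)) u) = c *\<^sub>C g u"
      by (induction u) (auto simp: g_def fl scaleC_add_right)
    then show ?thesis using A_abs[of u] A_abs[of "image_mset (\<lambda>(a, b). (c *\<^sub>C a, b)) u"]
      by (simp add: u flip: abs_atensor_simps(3))
  qed
  have A_diff: "A (s - t) = A s - A t" for s t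
    using A_add[of "s - t" t] by simp
  have A_bound: "norm (A t) \<le> K * proj_norm t" for t
  proof -
    have gb: "norm (g u) \<le> K * (\<Sum>(a, b)\<in>#u. norm a * norm b)" for u
    proof (induction u)
      case (add x u)
      obtain a b where x: "x = (a, b)" by (cases x)
      have "norm (f a b + g u) \<le> norm a * norm b * K + K * (\<Sum>(a, b)\<in>#u. norm a * norm b)"
        by (rule order_trans[OF norm_triangle_ineq add_mono[OF K(2) add.IH]])
      then show ?case by (simp add: x g_def algebra_simps)
    qed (simp add: g_def)
    have "norm (A t) / K \<le> proj_norm t"
    proof (rule ccontr)
      assume "\<not> norm (A t) / K \<le> proj_norm t"
      then obtain u where u: "abs_atensor u = t" "(\<Sum>(a, b)\<in>#u. norm a * norm b) < norm (A t) / K"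
        using proj_norm_less[of t "norm (A t) / K"] by force
      then show False using gb[of u] A_abs[of u] K(1) by (simp add: field_simps)
    qed
    then show ?thesis using K(1) by (simp add: field_simps)
  qed
  have A_Cauchy: "Cauchy (\<lambda>n. A (S n))" if S: "proj_Cauchy S" for S
  proof (rule CauchyI)
    fix e :: real assume "0 < e"
    then have "0 < e / K" using K(1) by simp
    with S obtain N where N: "\<And>m n. m \<ge> N \<Longrightarrow> n \<ge> N \<Longrightarrow> proj_norm (S m - S n) < e / K"
      unfolding proj_Cauchy_def by blast
    have "norm (A (S m) - A (S n)) < e" if "m \<ge> N" "n \<ge> N" for m n
    proof -
      have "norm (A (S m) - A (S n)) \<le> K * proj_norm (S m - S n)"
        using A_bound[of "S m - S n"] by (simp add: A_diff)
      also have "\<dots> < e" using N[OF that] K(1) by (simp add: pos_less_divide_eq mult.commute)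
      finally show ?thesis .
    qed
    then show "\<exists>N. \<forall>m\<ge>N. \<forall>n\<ge>N. norm (A (S m) - A (S n)) < e" by blast
  qed
  define L where "L x = lim (\<lambda>n. A (rep_ptensor x n))" for x
  have rep: "abs_ptensor (rep_ptensor x) = x" "proj_Cauchy (rep_ptensor x)" for x :: "('a, 'b) ptensor"
    using Quotient3_abs_rep[OF Quotient3_ptensor, of x] Quotient3_rep_reflp[OF Quotient3_ptensor, of x]
    by (simp_all add: cauchy_rel_def)
  have L_rep: "(\<lambda>n. A (rep_ptensor x n)) \<longlonglongrightarrow> L x" for x
    unfolding L_def
    by (rule convergent_LIMSEQ_iff[THEN iffD1, OF Cauchy_convergent[OF A_Cauchy[OF rep(2)]]])
  have L_lim: "(\<lambda>n. A (S n)) \<longlonglongrightarrow> L (abs_ptensor S)" if S: "proj_Cauchy S" for S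
  proof -
    define R where "R = rep_ptensor (abs_ptensor S)"
    have "cauchy_rel S R"
      using Quotient3_rel[OF Quotient3_ptensor, of S R] S rep[of "abs_ptensor S"]
      by (simp add: cauchy_rel_refl R_def)
    then have "(\<lambda>n. proj_norm (S n - R n)) \<longlonglongrightarrow> 0" by (simp add: cauchy_rel_def)
    then have null: "(\<lambda>n. K * proj_norm (S n - R n)) \<longlonglongrightarrow> 0" by (rule tendsto_mult_right_zero)
    have "(\<lambda>n. A (S n) - A (R n)) \<longlonglongrightarrow> 0"
      by (rule Lim_null_comparison[OF _ null]) (intro always_eventually allI, metis A_bound A_diff)
    from tendsto_add[OF this L_rep[of "abs_ptensor S", folded R_def]] show ?thesis by simp
  qed
  have L_add: "L (x + y) = L x + L y" for x y
  proof -
    have "x + y = abs_ptensor (\<lambda>n. rep_ptensor x n + rep_ptensor y n)"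
      using plus_ptensor.abs_eq[OF cauchy_rel_refl[OF rep(2)[of x]] cauchy_rel_refl[OF rep(2)[of y]]]
      by (simp add: rep(1))
    then have "(\<lambda>n. A (rep_ptensor x n + rep_ptensor y n)) \<longlonglongrightarrow> L (x + y)"
      using L_lim[OF proj_Cauchy_add[OF rep(2)[of x] rep(2)[of y]]] by simp
    moreover have "(\<lambda>n. A (rep_ptensor x n + rep_ptensor y n)) \<longlonglongrightarrow> L x + L y"
      unfolding A_add by (rule tendsto_add[OF L_rep L_rep])
    ultimately show ?thesis by (rule LIMSEQ_unique)
  qed
  have tendsto_sc: "(\<lambda>n. c *\<^sub>C h n) \<longlonglongrightarrow> c *\<^sub>C l" if "h \<longlonglongrightarrow> l" for c and h :: "nat \<Rightarrow> 'c" and l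
  proof -
    have "bounded_linear (\<lambda>x :: 'c. c *\<^sub>C x)"
      by (rule bounded_linear_intro[of _ "norm c"])
        (simp_all add: scaleC_add_right scaleR_scaleC scaleC_scaleC norm_scaleC mult.commute)
    from bounded_linear.tendsto[OF this that] show ?thesis .
  qed
  have L_scale: "L (c *\<^sub>C x) = c *\<^sub>C L x" for c x
  proof -
    have "c *\<^sub>C x = abs_ptensor (\<lambda>n. c *\<^sub>C rep_ptensor x n)"
      using scaleC_ptensor.abs_eq[OF cauchy_rel_refl[OF rep(2)[of x]], of c] by (simp add: rep(1))
    then have "(\<lambda>n. A (c *\<^sub>C rep_ptensor x n)) \<longlonglongrightarrow> L (c *\<^sub>C x)"
      using L_lim[OF proj_Cauchy_scaleC[OF rep(2)[of x], of c]] by simp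
    moreover have "(\<lambda>n. A (c *\<^sub>C rep_ptensor x n)) \<longlonglongrightarrow> c *\<^sub>C L x"
      unfolding A_scale by (rule tendsto_sc[OF L_rep])
    ultimately show ?thesis by (rule LIMSEQ_unique)
  qed
  have L_bound: "norm (L x) \<le> norm x * K" for x
  proof -
    have "norm x = lim (\<lambda>n. proj_norm (rep_ptensor x n))"
      using norm_ptensor.abs_eq[OF cauchy_rel_refl[OF rep(2)[of x]]] by (simp add: rep(1))
    then have "(\<lambda>n. proj_norm (rep_ptensor x n) * K) \<longlonglongrightarrow> norm x * K"
      using proj_Cauchy_norm_lim[OF rep(2)[of x]] by (intro tendsto_mult tendsto_const) simp
    then show ?thesis
      by (rule LIMSEQ_le[OF tendsto_norm[OF L_rep[of x]]])
        (simp add: A_bound mult.commute[of _ K])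
  qed
  have "bounded_clinear L"
    unfolding bounded_clinear_def
    using bounded_linear_intro[of L K] L_add L_scale L_bound by (simp add: scaleR_scaleC)
  moreover have "L (a \<otimes>\<^sub>\<pi> b) = f a b" for a b
  proof -
    have "(\<lambda>n. A (abs_atensor {#(a, b)#})) \<longlonglongrightarrow> L (a \<otimes>\<^sub>\<pi> b)"
      using L_lim[OF proj_Cauchy_const[of "abs_atensor {#(a, b)#}"]]
      by (simp add: tensor_def of_atensor_def)
    then have "L (a \<otimes>\<^sub>\<pi> b) = A (abs_atensor {#(a, b)#})" by (simp add: LIMSEQ_const_iff)
    then show ?thesis by (simp add: A_abs g_def)
  qed
  ultimately show ?thesis using L_bound by blast
qed

text \<open>Well defined for bounded bilinear \<open>f\<close> with values in a Banach space: see
  \<open>ptensor_lift_ex1\<close> below.\<close>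

definition ptensor_lift ::
  "('a::complex_normed_vector \<Rightarrow> 'b::complex_normed_vector \<Rightarrow> 'c::complex_banach) \<Rightarrow>
   ('a, 'b) ptensor \<Rightarrow> 'c" where
  "ptensor_lift f = (THE T. bounded_clinear T \<and> (\<forall>a b. T (a \<otimes>\<^sub>\<pi> b) = f a b))"

lemma ptensor_lift_ex1:
  fixes f :: "'a::complex_normed_vector \<Rightarrow> 'b::complex_normed_vector \<Rightarrow> 'c::complex_banach"
  assumes "bounded_cbilinear f"
  shows "\<exists>!T. bounded_clinear T \<and> (\<forall>a b. T (a \<otimes>\<^sub>\<pi> b) = f a b)"
proof (rule ex_ex1I)
  have "bounded_bilinear f" using assms by (simp add: bounded_cbilinear_def)
  then obtain K where "0 < K" "\<And>a b. norm (f a b) \<le> norm a * norm b * K"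
    using bounded_bilinear.pos_bounded by blast
  from ptensor_lift_exists[OF assms this]
  show "\<exists>T. bounded_clinear T \<and> (\<forall>a b. T (a \<otimes>\<^sub>\<pi> b) = f a b)" by blast
next
  fix T U
  assume "bounded_clinear T \<and> (\<forall>a b. T (a \<otimes>\<^sub>\<pi> b) = f a b)"
    and "bounded_clinear U \<and> (\<forall>a b. U (a \<otimes>\<^sub>\<pi> b) = f a b)"
  then show "T = U" by (intro bounded_clinear_ptensor_eqI) auto
qed

lemma
  assumes "bounded_cbilinear f"
  shows bounded_clinear_ptensor_lift: "bounded_clinear (ptensor_lift f)"
    and ptensor_lift_tensor: "ptensor_lift f (a \<otimes>\<^sub>\<pi> b) = f a b"
  using theI'[OF ptensor_lift_ex1[OF assms]] by (auto simp: ptensor_lift_def)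

lemma ptensor_lift_eqI:
  assumes "bounded_clinear T" and "\<And>a b. T (a \<otimes>\<^sub>\<pi> b) = f a b" and "bounded_cbilinear f"
  shows "ptensor_lift f = T"
  using assms by (intro bounded_clinear_ptensor_eqI)
    (auto simp: bounded_clinear_ptensor_lift ptensor_lift_tensor)

lemma norm_ptensor_lift_le:
  assumes f: "bounded_cbilinear f" and K: "0 \<le> K" "\<And>a b. norm (f a b) \<le> norm a * norm b * K"
  shows "norm (ptensor_lift f x) \<le> norm x * K"
proof (rule field_le_epsilon)
  fix e :: real assume e: "0 < e"
  define K' where "K' = K + e / (norm x + 1)"
  have pos: "0 < norm x + 1" by (simp add: add_nonneg_pos)
  have K': "0 < K'" using K(1) e pos by (simp add: K'_def add_nonneg_pos)
  have "K \<le> K'" using e pos by (simp add: K'_def)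
  then have "norm (f a b) \<le> norm a * norm b * K'" for a b
    by (rule order_trans[OF K(2) mult_left_mono]) simp
  from ptensor_lift_exists[OF f K' this] obtain T where T: "bounded_clinear T"
      "\<And>a b. T (a \<otimes>\<^sub>\<pi> b) = f a b" "\<And>x. norm (T x) \<le> norm x * K'" by blast
  have "norm (ptensor_lift f x) \<le> norm x * K'"
    using T(3) by (simp add: ptensor_lift_eqI[OF T(1,2) f])
  also have "\<dots> = norm x * K + (norm x / (norm x + 1)) * e"
    by (simp add: K'_def distrib_left)
  also have "\<dots> \<le> norm x * K + 1 * e"
    using pos e by (intro add_left_mono mult_right_mono) simp_all
  finally show "norm (ptensor_lift f x) \<le> norm x * K + e" by simp
qed


section \<open>Banach bimodules and derivations\<close>

definition banach_bimodule ::
  "('a::complex_banach_algebra \<Rightarrow> 'x::complex_banach \<Rightarrow> 'x) \<Rightarrow> ('x \<Rightarrow> 'a \<Rightarrow> 'x) \<Rightarrow> bool" where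
  "banach_bimodule l r \<longleftrightarrow> bounded_cbilinear l \<and> bounded_cbilinear r \<and>
     (\<forall>a b x. l (a * b) x = l a (l b x)) \<and>
     (\<forall>a b x. r x (a * b) = r (r x a) b) \<and>
     (\<forall>a b x. l a (r x b) = r (l a x) b)"

definition derivation ::
  "('a::complex_banach_algebra \<Rightarrow> 'x::complex_banach \<Rightarrow> 'x) \<Rightarrow> ('x \<Rightarrow> 'a \<Rightarrow> 'x) \<Rightarrow> ('a \<Rightarrow> 'x) \<Rightarrow> bool" where
  "derivation l r D \<longleftrightarrow> bounded_clinear D \<and> (\<forall>a b. D (a * b) = l a (D b) + r (D a) b)"

definition inner_derivation ::
  "('a::complex_banach_algebra \<Rightarrow> 'x::complex_banach \<Rightarrow> 'x) \<Rightarrow> ('x \<Rightarrow> 'a \<Rightarrow> 'x) \<Rightarrow> ('a \<Rightarrow> 'x) \<Rightarrow> bool" where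
  "inner_derivation l r D \<longleftrightarrow> (\<exists>x. \<forall>a. D a = l a x - r x a)"

text \<open>\<open>'x\<close> ranges over the underlying Banach spaces of the bimodules; a theorem that leaves it
  free speaks about all of them.\<close>

definition boundedly_approximately_contractible ::
  "'a::complex_banach_algebra itself \<Rightarrow> 'x::complex_banach itself \<Rightarrow> bool" where
  "boundedly_approximately_contractible _ _ \<longleftrightarrow>
     (\<forall>l r (D :: 'a \<Rightarrow> 'x). banach_bimodule l r \<and> derivation l r D \<longrightarrow>
        (\<exists>(I :: ('a \<Rightarrow> 'x) net_index set) s E. directed_set I s \<and>
           (\<forall>i\<in>I. inner_derivation l r (E i)) \<and>
           (\<exists>C. \<forall>i\<in>I. onorm (E i) \<le> C) \<and>
           (\<forall>a. ((\<lambda>i. E i a) \<longlongrightarrow> D a) (net_filter I s))))"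


section \<open>Approximate identities and approximate diagonals\<close>

definition central_bounded_approximate_identity ::
  "'i set \<Rightarrow> ('i \<times> 'i) set \<Rightarrow> ('i \<Rightarrow> 'a::complex_banach_algebra) \<Rightarrow> bool" where
  "central_bounded_approximate_identity I r e \<longleftrightarrow> directed_set I r \<and>
     (\<exists>C. \<forall>i\<in>I. norm (e i) \<le> C) \<and>
     (\<forall>i\<in>I. \<forall>a. e i * a = a * e i) \<and>
     (\<forall>a. ((\<lambda>i. e i * a) \<longlongrightarrow> a) (net_filter I r))"

definition diag_map :: "('b::complex_banach_algebra, 'b) ptensor \<Rightarrow> 'b"  ("\<pi>")
  where "\<pi> = ptensor_lift (*)"

definition left_act ::
  "'b::complex_banach_algebra \<Rightarrow> ('b, 'b) ptensor \<Rightarrow> ('b, 'b) ptensor"  (infixr "\<bullet>\<^sub>l" 73)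
  where "c \<bullet>\<^sub>l M = ptensor_lift (\<lambda>a b. (c * a) \<otimes>\<^sub>\<pi> b) M"

definition right_act ::
  "('b::complex_banach_algebra, 'b) ptensor \<Rightarrow> 'b \<Rightarrow> ('b, 'b) ptensor"  (infixl "\<bullet>\<^sub>r" 73)
  where "M \<bullet>\<^sub>r c = ptensor_lift (\<lambda>a b. a \<otimes>\<^sub>\<pi> (b * c)) M"

definition approximate_diagonal ::
  "'i set \<Rightarrow> ('i \<times> 'i) set \<Rightarrow> ('i \<Rightarrow> ('b::complex_banach_algebra, 'b) ptensor) \<Rightarrow> bool" where
  "approximate_diagonal I r M \<longleftrightarrow> directed_set I r \<and>
     (\<forall>a. ((\<lambda>i. a \<bullet>\<^sub>l M i - M i \<bullet>\<^sub>r a) \<longlongrightarrow> 0) (net_filter I r)) \<and>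
     (\<forall>a. ((\<lambda>i. a * \<pi> (M i)) \<longlongrightarrow> a) (net_filter I r))"

definition multiplier_bounded ::
  "'i set \<Rightarrow> ('i \<Rightarrow> ('b::complex_banach_algebra, 'b) ptensor) \<Rightarrow> bool" where
  "multiplier_bounded I M \<longleftrightarrow> (\<exists>K. \<forall>a. \<forall>i\<in>I.
     norm (a \<bullet>\<^sub>l M i - M i \<bullet>\<^sub>r a) \<le> K * norm a \<and>
     norm (a * \<pi> (M i) - a) \<le> K * norm a \<and>
     norm (\<pi> (M i) * a - a) \<le> K * norm a)"

definition has_multiplier_bounded_approximate_diagonal ::
  "'b::complex_banach_algebra itself \<Rightarrow> bool" where
  "has_multiplier_bounded_approximate_diagonal _ \<longleftrightarrow>
     (\<exists>(I :: ('b, 'b) ptensor net_index set) r (M :: _ \<Rightarrow> ('b, 'b) ptensor).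
        approximate_diagonal I r M \<and> multiplier_bounded I M)"


lemma norm_tensor_le: "norm (a \<otimes>\<^sub>\<pi> b) \<le> norm a * norm b"
  using proj_norm_le[of "{#(a, b)#}"] by (simp add: tensor_def norm_of_atensor)

lemma bounded_bilinear_tensor: "bounded_bilinear (\<otimes>\<^sub>\<pi>)"
  and tensor_scaleC_left: "(c *\<^sub>C a) \<otimes>\<^sub>\<pi> b = c *\<^sub>C (a \<otimes>\<^sub>\<pi> b)"
  and tensor_scaleC_right: "a \<otimes>\<^sub>\<pi> (c *\<^sub>C b) = c *\<^sub>C (a \<otimes>\<^sub>\<pi> b)"
  using bounded_cbilinear_tensor by (auto simp: bounded_cbilinear_def)

lemma bounded_cbilinear_mult: "bounded_cbilinear ((*) :: 'b::complex_banach_algebra \<Rightarrow> _)"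
  by (simp add: bounded_cbilinear_def bounded_bilinear_mult mult_scaleC_left mult_scaleC_right)

lemma bounded_cbilinear_left_act:
  "bounded_cbilinear (\<lambda>a b. (c * a) \<otimes>\<^sub>\<pi> b)" for c :: "'b::complex_banach_algebra"
  using bounded_bilinear.comp[OF bounded_bilinear_tensor bounded_linear_mult_right[of c] bounded_linear_ident]
  by (simp add: bounded_cbilinear_def mult_scaleC_right tensor_scaleC_left tensor_scaleC_right)

lemma bounded_cbilinear_right_act:
  "bounded_cbilinear (\<lambda>a b. a \<otimes>\<^sub>\<pi> (b * c))" for c :: "'b::complex_banach_algebra"
  using bounded_bilinear.comp[OF bounded_bilinear_tensor bounded_linear_ident bounded_linear_mult_left[of c]]
  by (simp add: bounded_cbilinear_def mult_scaleC_left tensor_scaleC_left tensor_scaleC_right)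

lemma
  fixes c :: "'b::complex_banach_algebra"
  shows diag_map_tensor: "\<pi> (a \<otimes>\<^sub>\<pi> b) = a * b"
    and left_act_tensor: "c \<bullet>\<^sub>l (a \<otimes>\<^sub>\<pi> b) = (c * a) \<otimes>\<^sub>\<pi> b"
    and right_act_tensor: "(a \<otimes>\<^sub>\<pi> b) \<bullet>\<^sub>r c = a \<otimes>\<^sub>\<pi> (b * c)"
  by (simp_all add: diag_map_def left_act_def right_act_def ptensor_lift_tensor
      bounded_cbilinear_mult bounded_cbilinear_left_act bounded_cbilinear_right_act)

lemma bounded_clinear_diag_map: "bounded_clinear \<pi>"
  by (simp add: diag_map_def bounded_clinear_ptensor_lift bounded_cbilinear_mult)

lemma bounded_clinear_left_act: "bounded_clinear (\<lambda>M. c \<bullet>\<^sub>l M)"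
  by (simp add: left_act_def bounded_clinear_ptensor_lift bounded_cbilinear_left_act)

lemma bounded_clinear_right_act: "bounded_clinear (\<lambda>M. M \<bullet>\<^sub>r c)"
  by (simp add: right_act_def bounded_clinear_ptensor_lift bounded_cbilinear_right_act)

lemma bounded_clinear_scaleC: "bounded_clinear (\<lambda>x. c *\<^sub>C (x :: 'x::complex_normed_vector))"
  unfolding bounded_clinear_def
proof
  show "bounded_linear (\<lambda>x :: 'x. c *\<^sub>C x)"
    by (rule bounded_linear_intro[of _ "norm c"])
      (simp_all add: scaleC_add_right scaleR_scaleC scaleC_scaleC norm_scaleC mult.commute)
qed (simp add: scaleC_scaleC mult.commute)

lemma bounded_clinear_compose: "bounded_clinear f \<Longrightarrow> bounded_clinear g \<Longrightarrow> bounded_clinear (\<lambda>x. f (g x))"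
  unfolding bounded_clinear_def by (simp add: bounded_linear_compose)

lemma bounded_clinear_plus: "bounded_clinear f \<Longrightarrow> bounded_clinear g \<Longrightarrow> bounded_clinear (\<lambda>x. f x + g x)"
  unfolding bounded_clinear_def by (simp add: bounded_linear_add scaleC_add_right)

lemma norm_left_act_le: "norm (c \<bullet>\<^sub>l M) \<le> norm M * norm c"
  unfolding left_act_def
proof (rule norm_ptensor_lift_le[OF bounded_cbilinear_left_act norm_ge_zero])
  fix a b
  have "norm ((c * a) \<otimes>\<^sub>\<pi> b) \<le> norm c * norm a * norm b"
    by (rule order_trans[OF norm_tensor_le mult_right_mono[OF norm_mult_ineq]]) simp
  then show "norm ((c * a) \<otimes>\<^sub>\<pi> b) \<le> norm a * norm b * norm c" by (simp add: ac_simps)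
qed

lemma norm_right_act_le: "norm (M \<bullet>\<^sub>r c) \<le> norm M * norm c"
  unfolding right_act_def
proof (rule norm_ptensor_lift_le[OF bounded_cbilinear_right_act norm_ge_zero])
  fix a b
  have "norm (a \<otimes>\<^sub>\<pi> (b * c)) \<le> norm a * (norm b * norm c)"
    by (rule order_trans[OF norm_tensor_le mult_left_mono[OF norm_mult_ineq]]) simp
  then show "norm (a \<otimes>\<^sub>\<pi> (b * c)) \<le> norm a * norm b * norm c" by (simp add: ac_simps)
qed

lemma banach_bimodule_ptensor:
  "banach_bimodule (\<bullet>\<^sub>l) ((\<bullet>\<^sub>r) :: ('b::complex_banach_algebra, 'b) ptensor \<Rightarrow> _)"
proof -
  note bl = bounded_clinear_left_act bounded_clinear_right_act bounded_clinear_plus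
    bounded_clinear_compose[OF bounded_clinear_scaleC bounded_clinear_left_act]
    bounded_clinear_compose[OF bounded_clinear_scaleC bounded_clinear_right_act]
    bounded_clinear_compose[OF bounded_clinear_left_act bounded_clinear_left_act]
    bounded_clinear_compose[OF bounded_clinear_right_act bounded_clinear_right_act]
    bounded_clinear_compose[OF bounded_clinear_left_act bounded_clinear_right_act]
    bounded_clinear_compose[OF bounded_clinear_right_act bounded_clinear_left_act]
  note tens = left_act_tensor right_act_tensor distrib_left distrib_right mult.assoc
    mult_scaleC_left mult_scaleC_right tensor_scaleC_left tensor_scaleC_right
    bounded_bilinear.add_left[OF bounded_bilinear_tensor]
    bounded_bilinear.add_right[OF bounded_bilinear_tensor]
  have l: "(\<lambda>M. (c + d) \<bullet>\<^sub>l M) = (\<lambda>M. c \<bullet>\<^sub>l M + d \<bullet>\<^sub>l M)"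
    "(\<lambda>M. (k *\<^sub>C c) \<bullet>\<^sub>l M) = (\<lambda>M. k *\<^sub>C (c \<bullet>\<^sub>l M))"
    "(\<lambda>M. (c * d) \<bullet>\<^sub>l M) = (\<lambda>M. c \<bullet>\<^sub>l d \<bullet>\<^sub>l M)" for c d :: 'b and k
    by (rule bounded_clinear_ptensor_eqI; simp add: bl tens)+
  have r: "(\<lambda>M. M \<bullet>\<^sub>r (c + d)) = (\<lambda>M. M \<bullet>\<^sub>r c + M \<bullet>\<^sub>r d)"
    "(\<lambda>M. M \<bullet>\<^sub>r (k *\<^sub>C c)) = (\<lambda>M. k *\<^sub>C (M \<bullet>\<^sub>r c))"
    "(\<lambda>M. M \<bullet>\<^sub>r (c * d)) = (\<lambda>M. M \<bullet>\<^sub>r c \<bullet>\<^sub>r d)" for c d :: 'b and k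
    by (rule bounded_clinear_ptensor_eqI; simp add: bl tens)+
  have lr: "(\<lambda>M. c \<bullet>\<^sub>l (M \<bullet>\<^sub>r d)) = (\<lambda>M. (c \<bullet>\<^sub>l M) \<bullet>\<^sub>r d)" for c d :: 'b
    by (rule bounded_clinear_ptensor_eqI) (simp_all add: bl tens)
  have lin: "c \<bullet>\<^sub>l (M + N) = c \<bullet>\<^sub>l M + c \<bullet>\<^sub>l N" "c \<bullet>\<^sub>l (k *\<^sub>C M) = k *\<^sub>C (c \<bullet>\<^sub>l M)"
    "(M + N) \<bullet>\<^sub>r c = M \<bullet>\<^sub>r c + N \<bullet>\<^sub>r c" "(k *\<^sub>C M) \<bullet>\<^sub>r c = k *\<^sub>C (M \<bullet>\<^sub>r c)" for c :: 'b and M N k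
    using bounded_clinear_left_act[of c] bounded_clinear_right_act[of c]
      linear_add[OF bounded_linear.linear, of "\<lambda>M. c \<bullet>\<^sub>l M" M N]
      linear_add[OF bounded_linear.linear, of "\<lambda>M. M \<bullet>\<^sub>r c" M N]
    by (simp_all add: bounded_clinear_def)
  have "bounded_bilinear ((\<bullet>\<^sub>l) :: 'b \<Rightarrow> _)"
    by (intro bounded_bilinear.intro exI[of _ 1])
      (use norm_left_act_le in \<open>auto simp: lin scaleR_scaleC fun_cong[OF l(1)] fun_cong[OF l(2)] mult.commute\<close>)
  moreover have "bounded_bilinear ((\<bullet>\<^sub>r) :: ('b, 'b) ptensor \<Rightarrow> _)"
    by (intro bounded_bilinear.intro exI[of _ 1])
      (use norm_right_act_le in \<open>auto simp: lin scaleR_scaleC fun_cong[OF r(1)] fun_cong[OF r(2)]\<close>)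
  ultimately show ?thesis
    by (simp add: banach_bimodule_def bounded_cbilinear_def lin fun_cong[OF l(2)] fun_cong[OF l(3)]
        fun_cong[OF r(2)] fun_cong[OF r(3)] fun_cong[OF lr])
qed

lemma has_multiplier_bounded_approximate_diagonalI:
  fixes M :: "'i \<Rightarrow> ('b::complex_banach_algebra, 'b) ptensor"
  assumes "approximate_diagonal I r M" and "multiplier_bounded I M"
  shows "has_multiplier_bounded_approximate_diagonal TYPE('b)"
proof -
  have "directed_set I r" using assms(1) by (simp add: approximate_diagonal_def)
  from net_reindex[OF this, of M] obtain J :: "('b, 'b) ptensor net_index set" and s
    where J: "directed_set J s" "snd ` J \<subseteq> M ` I"
      and eq: "filtermap snd (net_filter J s) = filtermap M (net_filter I r)"
    by blast
  have lim: "((\<lambda>j. h (snd j)) \<longlongrightarrow> l) (net_filter J s) \<longleftrightarrow> ((\<lambda>i. h (M i)) \<longlongrightarrow> l) (net_filter I r)"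
    for h :: "('b, 'b) ptensor \<Rightarrow> 'c::topological_space" and l
    using arg_cong[OF eq, of "filtermap h"] by (simp add: filterlim_def filtermap_filtermap)
  have "approximate_diagonal J s snd"
    using assms(1) J(1) unfolding approximate_diagonal_def
    by (metis (no_types, lifting) lim[of "\<lambda>m. a \<bullet>\<^sub>l m - m \<bullet>\<^sub>r a" for a] lim[of "\<lambda>m. a * \<pi> m" for a])
  moreover have "multiplier_bounded J snd"
  proof -
    obtain K where "\<forall>a. \<forall>i\<in>I. norm (a \<bullet>\<^sub>l M i - M i \<bullet>\<^sub>r a) \<le> K * norm a \<and>
        norm (a * \<pi> (M i) - a) \<le> K * norm a \<and> norm (\<pi> (M i) * a - a) \<le> K * norm a"
      using assms(2) unfolding multiplier_bounded_def by blast
    moreover have "\<exists>i\<in>I. snd j = M i" if "j \<in> J" for j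
      using J(2) that by auto
    ultimately show ?thesis unfolding multiplier_bounded_def by (metis (no_types, lifting))
  qed
  ultimately show ?thesis
    unfolding has_multiplier_bounded_approximate_diagonal_def by blast
qed


section \<open>The forced unitization\<close>

datatype 'a unitization = Unitization (alg_part: 'a) (scalar_part: complex)

instantiation unitization :: (complex_normed_vector) complex_normed_vector
begin

definition zero_unitization :: "'a unitization"
  where "zero_unitization = Unitization 0 0"

definition plus_unitization :: "'a unitization \<Rightarrow> 'a unitization \<Rightarrow> 'a unitization"
  where "plus_unitization x y =
    Unitization (alg_part x + alg_part y) (scalar_part x + scalar_part y)"

definition uminus_unitization :: "'a unitization \<Rightarrow> 'a unitization"
  where "uminus_unitization x = Unitization (- alg_part x) (- scalar_part x)"

definition minus_unitization :: "'a unitization \<Rightarrow> 'a unitization \<Rightarrow> 'a unitization"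
  where "minus_unitization x y =
    Unitization (alg_part x - alg_part y) (scalar_part x - scalar_part y)"

definition scaleC_unitization :: "complex \<Rightarrow> 'a unitization \<Rightarrow> 'a unitization"
  where "scaleC_unitization c x = Unitization (c *\<^sub>C alg_part x) (c * scalar_part x)"

definition scaleR_unitization :: "real \<Rightarrow> 'a unitization \<Rightarrow> 'a unitization"
  where "scaleR_unitization r x = Unitization (r *\<^sub>R alg_part x) (r *\<^sub>R scalar_part x)"

definition norm_unitization :: "'a unitization \<Rightarrow> real"
  where "norm_unitization x = norm (alg_part x) + norm (scalar_part x)"

definition sgn_unitization :: "'a unitization \<Rightarrow> 'a unitization"
  where "sgn_unitization x = inverse (norm x) *\<^sub>R x"

definition dist_unitization :: "'a unitization \<Rightarrow> 'a unitization \<Rightarrow> real"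
  where "dist_unitization x y = norm (x - y)"

definition uniformity_unitization :: "('a unitization \<times> 'a unitization) filter"
  where "uniformity_unitization = (INF e\<in>{0 <..}. principal {(x, y). dist x y < e})"

definition open_unitization :: "'a unitization set \<Rightarrow> bool"
  where "open_unitization U \<longleftrightarrow> (\<forall>x\<in>U. eventually (\<lambda>(x', y). x' = x \<longrightarrow> y \<in> U) uniformity)"

lemmas unitization_defs = zero_unitization_def plus_unitization_def uminus_unitization_def
  minus_unitization_def scaleC_unitization_def scaleR_unitization_def norm_unitization_def

instance
proof
  fix x y :: "'a unitization" and c :: complex and r :: real and U :: "'a unitization set"
  show "norm x = 0 \<longleftrightarrow> x = 0"
    by (cases x) (simp add: unitization_defs add_nonneg_eq_0_iff)
  show "norm (x + y) \<le> norm x + norm y"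
    using norm_triangle_ineq[of "alg_part x" "alg_part y"]
      norm_triangle_ineq[of "scalar_part x" "scalar_part y"]
    by (simp add: unitization_defs)
  show "sgn x = inverse (norm x) *\<^sub>R x" by (fact sgn_unitization_def)
  show "dist x y = norm (x - y)" by (fact dist_unitization_def)
  show "(uniformity :: ('a unitization \<times> 'a unitization) filter) =
      (INF e\<in>{0 <..}. principal {(x, y). dist x y < e})"
    by (fact uniformity_unitization_def)
  show "open U \<longleftrightarrow> (\<forall>x\<in>U. eventually (\<lambda>(x', y). x' = x \<longrightarrow> y \<in> U) uniformity)"
    by (fact open_unitization_def)
qed (simp_all add: unitization_defs algebra_simps scaleC_add_right scaleC_add_left scaleC_scaleC
    scaleC_one scaleR_conv_of_real scaleR_scaleC[where 'a = 'a] norm_scaleC norm_mult)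

end

instance unitization :: (complex_banach) complex_banach
proof
  fix X :: "nat \<Rightarrow> 'a unitization"
  assume X: "Cauchy X"
  have n: "norm (alg_part (x - y)) \<le> norm (x - y)" "norm (scalar_part (x - y)) \<le> norm (x - y)"
    "alg_part (x - y) = alg_part x - alg_part y" "scalar_part (x - y) = scalar_part x - scalar_part y"
    for x y :: "'a unitization"
    by (simp_all add: unitization_defs)
  have "Cauchy (\<lambda>n. alg_part (X n))"
    using X unfolding Cauchy_iff by (metis n(1,3) order.strict_trans1)
  then obtain a where a: "(\<lambda>n. alg_part (X n)) \<longlonglongrightarrow> a"
    by (auto simp: Cauchy_convergent_iff convergent_def)
  have "Cauchy (\<lambda>n. scalar_part (X n))"
    using X unfolding Cauchy_iff by (metis n(2,4) order.strict_trans1)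
  then obtain l where l: "(\<lambda>n. scalar_part (X n)) \<longlonglongrightarrow> l"
    by (auto simp: Cauchy_convergent_iff convergent_def)
  have "(\<lambda>n. norm (alg_part (X n) - a) + norm (scalar_part (X n) - l)) \<longlonglongrightarrow> 0"
    using a l by (intro tendsto_add_zero tendsto_norm_zero) (simp_all add: LIM_zero)
  then have "(\<lambda>n. X n - Unitization a l) \<longlonglongrightarrow> 0"
    by (subst tendsto_norm_zero_iff[symmetric]) (simp add: unitization_defs)
  then have "X \<longlonglongrightarrow> Unitization a l" by (rule LIM_zero_cancel)
  then show "convergent X" by (rule convergentI)
qed

instantiation unitization :: (complex_banach_algebra) complex_banach_algebra
begin

definition times_unitization :: "'a unitization \<Rightarrow> 'a unitization \<Rightarrow> 'a unitization"
  where "times_unitization x y =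
    Unitization (alg_part x * alg_part y + scalar_part x *\<^sub>C alg_part y + scalar_part y *\<^sub>C alg_part x)
      (scalar_part x * scalar_part y)"

instance
proof
  fix x y z :: "'a unitization" and c :: complex and r :: real
  show "norm (x * y) \<le> norm x * norm y"
  proof -
    have "norm (x * y) \<le> norm (alg_part x * alg_part y) + norm (scalar_part x *\<^sub>C alg_part y)
        + norm (scalar_part y *\<^sub>C alg_part x) + norm (scalar_part x * scalar_part y)"
      unfolding times_unitization_def norm_unitization_def unitization.sel
      by (intro add_right_mono order_trans[OF norm_triangle_ineq] add_mono order_refl
          norm_triangle_ineq)
    also have "\<dots> \<le> norm x * norm y"
      using norm_mult_ineq[of "alg_part x" "alg_part y"]
      by (simp add: norm_unitization_def norm_scaleC norm_mult algebra_simps)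
    finally show ?thesis .
  qed
qed (simp_all add: times_unitization_def unitization_defs algebra_simps scaleC_add_right
    scaleC_add_left scaleC_scaleC mult_scaleC_left mult_scaleC_right scaleR_scaleC[where 'a = 'a]
    scaleR_conv_of_real)

end

instantiation unitization :: (complex_banach_algebra) real_normed_algebra_1
begin

definition one_unitization :: "'a unitization"
  where "one_unitization = Unitization 0 1"

instance
  by standard
    (simp_all add: one_unitization_def times_unitization_def unitization_defs scaleC_one)

end

end

theory Submission
  imports Defs
begin

text \<open>Identify \<open>A\<close> with its copy in \<open>A\<^sup>#\<close>. For central \<open>e\<close> put \<open>u = 2e - e\<^sup>2\<close>, so that
  \<open>1 - u = (1 - e)\<^sup>2\<close>, and consider \<open>N = u M + (1 - e) \<otimes> (1 - e)\<close>. Then \<open>\<pi> N - 1 = u \<pi>(M) - u\<close>,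
  and, as \<open>u\<close> is central, the commutator of \<open>N\<close> with \<open>b \<in> A\<close> is
  \<open>u (b M - M b) + (b - e b) \<otimes> (1 - e) - (1 - e) \<otimes> (b - e b)\<close>. Both are bounded by a multiple
  of the norm of \<open>b\<close>, and both become small if \<open>e\<close> is chosen first and \<open>M\<close> afterwards.

  Every derivation \<open>D\<close> on \<open>A\<close> extends to \<open>A\<^sup>#\<close> by \<open>D 1 = 0\<close>. If \<open>N = \<Sum>\<^sub>k a\<^sub>k \<otimes> b\<^sub>k\<close> and
  \<open>x = \<Sum>\<^sub>k a\<^sub>k D b\<^sub>k\<close>, then \<open>a x - x a\<close> differs from \<open>\<pi>(N) D a\<close> by the image of \<open>a N - N a\<close>
  under the bounded map \<open>a \<otimes> b \<mapsto> a D b\<close>.\<close>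

section \<open>Preliminaries\<close>

lemma eventually_net_filterD:
  assumes "directed_set I r" "eventually P (net_filter I r)"
  obtains i where "i \<in> I" "P i"
  using assms unfolding eventually_net_filter[OF assms(1)] directed_set_def preorder_on_def refl_on_def
  by blast

lemma eventually_mem_net_filter:
  assumes "directed_set I r"
  shows "eventually (\<lambda>i. i \<in> I) (net_filter I r)"
  using assms unfolding eventually_net_filter[OF assms] directed_set_def preorder_on_def refl_on_def
  by blast

lemma bounded_clinear_intro:
  assumes "\<And>x y. f (x + y) = f x + f y" "\<And>c x. f (c *\<^sub>C x) = c *\<^sub>C f x"
    and "\<And>x. norm (f x) \<le> norm x * K"
  shows "bounded_clinear f"
  unfolding bounded_clinear_def
  using assms by (auto intro!: bounded_linear_intro[of f K] simp: scaleR_scaleC)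

lemma bounded_cbilinear_intro:
  assumes "\<And>x y z. f (x + y) z = f x z + f y z" "\<And>x y z. f x (y + z) = f x y + f x z"
    and "\<And>c x y. f (c *\<^sub>C x) y = c *\<^sub>C f x y" "\<And>c x y. f x (c *\<^sub>C y) = c *\<^sub>C f x y"
    and "\<And>x y. norm (f x y) \<le> norm x * norm y * K"
  shows "bounded_cbilinear f"
proof -
  have "bounded_bilinear f"
    by (rule bounded_bilinear.intro) (use assms in \<open>auto simp: scaleR_scaleC\<close>)
  then show ?thesis using assms by (simp add: bounded_cbilinear_def)
qed

lemma bounded_clinear_add: "bounded_clinear f \<Longrightarrow> f (x + y) = f x + f y"
  and bounded_clinear_diff: "bounded_clinear f \<Longrightarrow> f (x - y) = f x - f y"
  and bounded_clinear_scaleCD: "bounded_clinear f \<Longrightarrow> f (c *\<^sub>C x) = c *\<^sub>C f x"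
  unfolding bounded_clinear_def
  by (auto simp: linear_simps)

lemma bounded_clinear_minus:
  "bounded_clinear f \<Longrightarrow> bounded_clinear g \<Longrightarrow> bounded_clinear (\<lambda>x. f x - g x)"
  unfolding bounded_clinear_def by (simp add: bounded_linear_sub scaleC_diff_right)

lemma bounded_cbilinear_act:
  fixes l :: "'b::complex_banach_algebra \<Rightarrow> 'x::complex_banach \<Rightarrow> 'x"
  assumes "bounded_cbilinear l"
  shows "bounded_clinear (l a)" "bounded_clinear (\<lambda>a. l a x)"
  using assms unfolding bounded_cbilinear_def bounded_clinear_def
  by (auto intro: bounded_bilinear.bounded_linear_left bounded_bilinear.bounded_linear_right)

section \<open>The bimodule structure of the projective tensor square\<close>

lemma
  fixes b c :: "'b::complex_banach_algebra"
  shows bounded_cbilinear_left_mult: "bounded_cbilinear ((\<bullet>\<^sub>l) :: 'b::complex_banach_algebra \<Rightarrow> _)"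
    and bounded_cbilinear_right_mult:
      "bounded_cbilinear ((\<bullet>\<^sub>r) :: ('b::complex_banach_algebra, 'b) ptensor \<Rightarrow> _)"
    and left_act_mult: "(b * c) \<bullet>\<^sub>l M = b \<bullet>\<^sub>l c \<bullet>\<^sub>l M"
    and left_right_act: "b \<bullet>\<^sub>l (M \<bullet>\<^sub>r c) = (b \<bullet>\<^sub>l M) \<bullet>\<^sub>r c"
  using banach_bimodule_ptensor[where 'b = 'b] by (simp_all add: banach_bimodule_def)

text \<open>Both sides are bounded and linear in \<open>M\<close>, so they need only be compared on
  elementary tensors, where the claim is associativity. The identities for tensors below follow the
  same pattern.\<close>

lemma diag_map_left_act: "\<pi> (c \<bullet>\<^sub>l M) = c * \<pi> M"
proof -
  have "(\<lambda>M. \<pi> (c \<bullet>\<^sub>l M)) = (\<lambda>M. c * \<pi> M)"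
    by (rule bounded_clinear_ptensor_eqI)
      (simp_all add: bounded_clinear_compose[OF bounded_clinear_diag_map bounded_clinear_left_act]
        bounded_clinear_compose[OF bounded_cbilinear_act(1)[OF bounded_cbilinear_mult] bounded_clinear_diag_map]
        left_act_tensor diag_map_tensor mult.assoc)
  then show ?thesis by (rule fun_cong)
qed

text \<open>Pairs of a finite set and a natural number index the net, so no iterated limit has to be
  formed: each tensor may be chosen freely for its pair. The constant \<open>K\<close> is fixed
  before \<open>F\<close> and \<open>\<epsilon>\<close>, which makes the net
  multiplier-bounded.\<close>

lemma has_multiplier_bounded_approximate_diagonal_finiteI:
  assumes "\<And>F \<epsilon>. finite F \<Longrightarrow> 0 < \<epsilon> \<Longrightarrow> \<exists>N :: ('b::complex_banach_algebra, 'b) ptensor.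
      (\<forall>a. norm (a \<bullet>\<^sub>l N - N \<bullet>\<^sub>r a) \<le> K * norm a \<and> norm (a * \<pi> N - a) \<le> K * norm a \<and>
           norm (\<pi> N * a - a) \<le> K * norm a) \<and>
      (\<forall>a\<in>F. norm (a \<bullet>\<^sub>l N - N \<bullet>\<^sub>r a) < \<epsilon> \<and> norm (a * \<pi> N - a) < \<epsilon>)"
  shows "has_multiplier_bounded_approximate_diagonal TYPE('b)"
proof -
  define I :: "('b set \<times> nat) set" where "I = {(F, n). finite F}"
  define r where "r = {(p, q). p \<in> I \<and> q \<in> I \<and> fst p \<subseteq> fst q \<and> snd p \<le> snd q}"
  have "\<forall>p\<in>I. \<exists>N :: ('b, 'b) ptensor.
      (\<forall>a. norm (a \<bullet>\<^sub>l N - N \<bullet>\<^sub>r a) \<le> K * norm a \<and> norm (a * \<pi> N - a) \<le> K * norm a \<and>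
           norm (\<pi> N * a - a) \<le> K * norm a) \<and>
      (\<forall>a\<in>fst p. norm (a \<bullet>\<^sub>l N - N \<bullet>\<^sub>r a) < inverse (Suc (snd p)) \<and>
        norm (a * \<pi> N - a) < inverse (Suc (snd p)))"
    by (intro ballI assms) (auto simp: I_def)
  then obtain N :: "_ \<Rightarrow> ('b, 'b) ptensor" where
    bd: "\<And>p a. p \<in> I \<Longrightarrow> norm (a \<bullet>\<^sub>l N p - N p \<bullet>\<^sub>r a) \<le> K * norm a \<and>
        norm (a * \<pi> (N p) - a) \<le> K * norm a \<and> norm (\<pi> (N p) * a - a) \<le> K * norm a"
    and small: "\<And>p a. p \<in> I \<Longrightarrow> a \<in> fst p \<Longrightarrow>
        norm (a \<bullet>\<^sub>l N p - N p \<bullet>\<^sub>r a) < inverse (Suc (snd p)) \<and>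
        norm (a * \<pi> (N p) - a) < inverse (Suc (snd p))"
    by metis
  have dir: "directed_set I r"
    unfolding directed_set_def
  proof (intro conjI ballI)
    show "I \<noteq> {}" by (auto simp: I_def)
    show "preorder_on I r"
      unfolding preorder_on_def refl_on_def r_def by (auto intro!: transI)
    fix p q assume "p \<in> I" "q \<in> I"
    then show "\<exists>k\<in>I. (p, k) \<in> r \<and> (q, k) \<in> r"
      by (intro bexI[of _ "(fst p \<union> fst q, max (snd p) (snd q))"]) (auto simp: I_def r_def)
  qed
  \<comment> \<open>From \<open>({a}, n)\<close> on, every index has \<open>a\<close> in its finite
    set and a tolerance of at most \<open>1 / (n + 1)\<close>. The codomain of \<open>f\<close>
    stays arbitrary, so this serves for tensors and for elements of the algebra.\<close>
  have conv: "(f \<longlongrightarrow> 0) (net_filter I r)"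
    if f: "\<And>p. p \<in> I \<Longrightarrow> a \<in> fst p \<Longrightarrow> norm (f p) < inverse (Suc (snd p))"
    for f :: "_ \<Rightarrow> 'c::real_normed_vector" and a
  proof (rule tendstoI)
    fix \<epsilon> :: real assume "0 < \<epsilon>"
    then obtain n where n: "inverse (real (Suc n)) < \<epsilon>" using reals_Archimedean by blast
    have "norm (f q) < \<epsilon>" if "(({a}, n), q) \<in> r" for q
    proof -
      have "norm (f q) < inverse (Suc (snd q))"
        using that by (intro f) (auto simp: r_def)
      also have "\<dots> \<le> inverse (Suc n)"
        using that by (intro le_imp_inverse_le) (auto simp: r_def)
      finally show ?thesis using n by simp
    qed
    then show "eventually (\<lambda>q. dist (f q) 0 < \<epsilon>) (net_filter I r)"
      unfolding eventually_net_filter[OF dir]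
      by (intro bexI[of _ "({a}, n)"]) (auto simp: I_def)
  qed
  have "approximate_diagonal I r N"
    unfolding approximate_diagonal_def
  proof (intro conjI allI dir)
    fix a
    show "((\<lambda>p. a \<bullet>\<^sub>l N p - N p \<bullet>\<^sub>r a) \<longlongrightarrow> 0) (net_filter I r)"
      using small by (intro conv[of a]) simp
    show "((\<lambda>p. a * \<pi> (N p)) \<longlongrightarrow> a) (net_filter I r)"
      using small by (intro LIM_zero_cancel[OF conv[of a]]) simp
  qed
  moreover have "multiplier_bounded I N"
    unfolding multiplier_bounded_def using bd by blast
  ultimately show ?thesis by (rule has_multiplier_bounded_approximate_diagonalI)
qed


section \<open>The approximate diagonal of the unitization\<close>

definition to_unitization :: "'a::complex_banach_algebra \<Rightarrow> 'a unitization" ("\<iota>")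
  where "\<iota> a = Unitization a 0"

lemma norm_to_unitization [simp]: "norm (\<iota> a) = norm a"
  by (simp add: to_unitization_def norm_unitization_def)

lemma bounded_clinear_to_unitization: "bounded_clinear \<iota>"
  by (rule bounded_clinear_intro[of _ 1])
    (simp_all add: to_unitization_def unitization_defs)

lemma to_unitization_mult: "\<iota> (a * b) = \<iota> a * \<iota> b"
  by (simp add: to_unitization_def times_unitization_def)

lemmas to_unitization_simps = bounded_clinear_add[OF bounded_clinear_to_unitization]
  bounded_clinear_diff[OF bounded_clinear_to_unitization] to_unitization_mult

lemma unitization_decomp: "x = \<iota> (alg_part x) + scalar_part x *\<^sub>C 1"
  by (cases x) (simp add: to_unitization_def one_unitization_def unitization_defs)

lemma norm_alg_part_le: "norm (alg_part x) \<le> norm x"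
  by (simp add: norm_unitization_def)

definition ptensor_to_unitization ::
  "('a::complex_banach_algebra, 'a) ptensor \<Rightarrow> ('a unitization, 'a unitization) ptensor" ("\<iota>\<^sub>2")
  where "\<iota>\<^sub>2 = ptensor_lift (\<lambda>a b. \<iota> a \<otimes>\<^sub>\<pi> \<iota> b)"

text \<open>The trailing factor is the bound \<open>K\<close> in the shape that
  \<open>bounded_cbilinear_intro\<close> and \<open>norm_ptensor_lift_le\<close> expect; its value 1
  makes \<open>\<iota>\<^sub>2\<close> a contraction.\<close>

lemma norm_tensor_to_unitization_le: "norm (\<iota> a \<otimes>\<^sub>\<pi> \<iota> b) \<le> norm a * norm b * 1"
  using norm_tensor_le[of "\<iota> a" "\<iota> b"] by simp

lemma bounded_cbilinear_tensor_to_unitization: "bounded_cbilinear (\<lambda>a b. \<iota> a \<otimes>\<^sub>\<pi> \<iota> b)"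
  by (rule bounded_cbilinear_intro[OF _ _ _ _ norm_tensor_to_unitization_le])
    (simp_all add: to_unitization_simps bounded_clinear_scaleCD[OF bounded_clinear_to_unitization]
      bounded_bilinear.add_left[OF bounded_bilinear_tensor]
      bounded_bilinear.add_right[OF bounded_bilinear_tensor] tensor_scaleC_left tensor_scaleC_right)

lemma ptensor_to_unitization_tensor: "\<iota>\<^sub>2 (a \<otimes>\<^sub>\<pi> b) = \<iota> a \<otimes>\<^sub>\<pi> \<iota> b"
  unfolding ptensor_to_unitization_def
  by (rule ptensor_lift_tensor[OF bounded_cbilinear_tensor_to_unitization])

lemma bounded_clinear_ptensor_to_unitization: "bounded_clinear \<iota>\<^sub>2"
  unfolding ptensor_to_unitization_def
  by (rule bounded_clinear_ptensor_lift[OF bounded_cbilinear_tensor_to_unitization])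

lemma norm_ptensor_to_unitization_le: "norm (\<iota>\<^sub>2 M) \<le> norm M"
  unfolding ptensor_to_unitization_def
  using norm_ptensor_lift_le[OF bounded_cbilinear_tensor_to_unitization _ norm_tensor_to_unitization_le]
  by simp

text \<open>On elementary tensors all three reduce to multiplicativity of \<open>\<iota>\<close>.
  They carry the estimates for tensors over A into the unitization.\<close>

lemma
  shows left_act_to_unitization: "\<iota> c \<bullet>\<^sub>l \<iota>\<^sub>2 M = \<iota>\<^sub>2 (c \<bullet>\<^sub>l M)"
    and right_act_to_unitization: "\<iota>\<^sub>2 M \<bullet>\<^sub>r \<iota> c = \<iota>\<^sub>2 (M \<bullet>\<^sub>r c)"
    and diag_map_to_unitization: "\<pi> (\<iota>\<^sub>2 M) = \<iota> (\<pi> M)"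
proof -
  note b = bounded_clinear_ptensor_to_unitization bounded_clinear_left_act bounded_clinear_right_act
    bounded_clinear_diag_map bounded_clinear_to_unitization
  have "(\<lambda>M. \<iota> c \<bullet>\<^sub>l \<iota>\<^sub>2 M) = (\<lambda>M. \<iota>\<^sub>2 (c \<bullet>\<^sub>l M))"
    by (intro bounded_clinear_ptensor_eqI bounded_clinear_compose[OF b(2,1)]
        bounded_clinear_compose[OF b(1,2)])
      (simp add: ptensor_to_unitization_tensor left_act_tensor to_unitization_mult)
  then show "\<iota> c \<bullet>\<^sub>l \<iota>\<^sub>2 M = \<iota>\<^sub>2 (c \<bullet>\<^sub>l M)" by (rule fun_cong)
  have "(\<lambda>M. \<iota>\<^sub>2 M \<bullet>\<^sub>r \<iota> c) = (\<lambda>M. \<iota>\<^sub>2 (M \<bullet>\<^sub>r c))"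
    by (intro bounded_clinear_ptensor_eqI bounded_clinear_compose[OF b(3,1)]
        bounded_clinear_compose[OF b(1,3)])
      (simp add: ptensor_to_unitization_tensor right_act_tensor to_unitization_mult)
  then show "\<iota>\<^sub>2 M \<bullet>\<^sub>r \<iota> c = \<iota>\<^sub>2 (M \<bullet>\<^sub>r c)" by (rule fun_cong)
  have "(\<lambda>M. \<pi> (\<iota>\<^sub>2 M)) = (\<lambda>M. \<iota> (\<pi> M))"
    by (intro bounded_clinear_ptensor_eqI bounded_clinear_compose[OF b(4,1)]
        bounded_clinear_compose[OF b(5,4)])
      (simp add: ptensor_to_unitization_tensor diag_map_tensor to_unitization_mult)
  then show "\<pi> (\<iota>\<^sub>2 M) = \<iota> (\<pi> M)" by (rule fun_cong)
qed

lemma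
  fixes N :: "('a::complex_banach_algebra unitization, 'a unitization) ptensor"
  shows left_act_one: "1 \<bullet>\<^sub>l N = N" and right_act_one: "N \<bullet>\<^sub>r 1 = N"
proof -
  have id: "bounded_clinear (\<lambda>N :: ('a unitization, 'a unitization) ptensor. N)"
    by (simp add: bounded_clinear_def)
  have "(\<lambda>N :: ('a unitization, 'a unitization) ptensor. 1 \<bullet>\<^sub>l N) = (\<lambda>N. N)"
    by (intro bounded_clinear_ptensor_eqI bounded_clinear_left_act id) (simp add: left_act_tensor)
  then show "1 \<bullet>\<^sub>l N = N" by (rule fun_cong)
  have "(\<lambda>N :: ('a unitization, 'a unitization) ptensor. N \<bullet>\<^sub>r 1) = (\<lambda>N. N)"
    by (intro bounded_clinear_ptensor_eqI bounded_clinear_right_act id) (simp add: right_act_tensor)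
  then show "N \<bullet>\<^sub>r 1 = N" by (rule fun_cong)
qed

text \<open>Scalar multiples of the identity act identically from both sides and cancel, so
  commutators over the unitization are governed by elements of A.\<close>

lemma commutator_unitization:
  fixes N :: "('a::complex_banach_algebra unitization, 'a unitization) ptensor"
  shows "x \<bullet>\<^sub>l N - N \<bullet>\<^sub>r x = \<iota> (alg_part x) \<bullet>\<^sub>l N - N \<bullet>\<^sub>r \<iota> (alg_part x)"
proof -
  note bl = bounded_cbilinear_act(2)[OF bounded_cbilinear_left_mult]
  have br: "bounded_clinear (\<lambda>x. N \<bullet>\<^sub>r x)"
    using bounded_cbilinear_right_mult[where 'b = "'a unitization"]
    unfolding bounded_cbilinear_def bounded_clinear_def
    by (auto intro: bounded_bilinear.bounded_linear_right)
  have "x \<bullet>\<^sub>l N = \<iota> (alg_part x) \<bullet>\<^sub>l N + scalar_part x *\<^sub>C N"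
    by (subst (1) unitization_decomp[of x])
      (simp only: bounded_clinear_add[OF bl] bounded_clinear_scaleCD[OF bl] left_act_one)
  moreover have "N \<bullet>\<^sub>r x = N \<bullet>\<^sub>r \<iota> (alg_part x) + scalar_part x *\<^sub>C N"
    by (subst (1) unitization_decomp[of x])
      (simp only: bounded_clinear_add[OF br] bounded_clinear_scaleCD[OF br] right_act_one)
  ultimately show ?thesis by simp
qed

text \<open>The element u is formed inside A, so that it acts on \<open>M\<close> before the
  embedding; only the second summand involves the adjoined identity.\<close>

definition unitization_diagonal ::
  "'a::complex_banach_algebra \<Rightarrow> ('a, 'a) ptensor \<Rightarrow> ('a unitization, 'a unitization) ptensor"
  where "unitization_diagonal e M =
    \<iota>\<^sub>2 ((e + e - e * e) \<bullet>\<^sub>l M) + (1 - \<iota> e) \<otimes>\<^sub>\<pi> (1 - \<iota> e)"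

text \<open>The second summand contributes
  \<open>(1 - \<iota> e) * (1 - \<iota> e) = 1 - \<iota> u\<close>. What remains is the defect
  \<open>a * \<pi> M - a\<close> at the single element \<open>a = u\<close>; having u on the left
  matches the limit in the definition of an approximate diagonal.\<close>

lemma diag_map_unitization_diagonal:
  "\<pi> (unitization_diagonal e M) = 1 + \<iota> ((e + e - e * e) * \<pi> M - (e + e - e * e))"
  unfolding unitization_diagonal_def bounded_clinear_add[OF bounded_clinear_diag_map]
    diag_map_to_unitization diag_map_left_act diag_map_tensor to_unitization_simps
  by (simp add: algebra_simps)

text \<open>As \<open>e\<close> is central, so is u, and it can be pulled out of the commutator of
  \<open>u M\<close> with \<open>b\<close>. Centrality also makes \<open>b (1 - e)\<close> and
  \<open>(1 - e) b\<close> the same element \<open>b - e b\<close>.\<close>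

lemma commutator_unitization_diagonal:
  fixes x :: "'a::complex_banach_algebra unitization"
  assumes central: "\<And>a. e * a = a * e"
  defines "b \<equiv> alg_part x" and "u \<equiv> e + e - e * e"
  shows "x \<bullet>\<^sub>l unitization_diagonal e M - unitization_diagonal e M \<bullet>\<^sub>r x =
    \<iota>\<^sub>2 (u \<bullet>\<^sub>l (b \<bullet>\<^sub>l M - M \<bullet>\<^sub>r b)) +
    (\<iota> (b - e * b) \<otimes>\<^sub>\<pi> (1 - \<iota> e) - (1 - \<iota> e) \<otimes>\<^sub>\<pi> \<iota> (b - e * b))"
proof -
  have "e * e * b = b * (e * e)" by (metis central mult.assoc)
  then have ub: "b * u = u * b"
    by (simp add: u_def left_diff_distrib right_diff_distrib distrib_left distrib_right central[of b])
  have "b \<bullet>\<^sub>l u \<bullet>\<^sub>l M - (u \<bullet>\<^sub>l M) \<bullet>\<^sub>r b = u \<bullet>\<^sub>l (b \<bullet>\<^sub>l M - M \<bullet>\<^sub>r b)"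
    by (simp add: ub left_right_act bounded_clinear_diff[OF bounded_clinear_left_act]
        flip: left_act_mult)
  moreover have "\<iota> b * (1 - \<iota> e) = \<iota> (b - e * b)" "(1 - \<iota> e) * \<iota> b = \<iota> (b - e * b)"
    by (simp_all add: left_diff_distrib right_diff_distrib central[of b]
        bounded_clinear_diff[OF bounded_clinear_to_unitization] flip: to_unitization_mult)
  ultimately show ?thesis
    unfolding commutator_unitization[of x] unitization_diagonal_def b_def[symmetric] u_def[symmetric]
    by (simp add: bounded_clinear_add[OF bounded_clinear_left_act]
        bounded_clinear_add[OF bounded_clinear_right_act] left_act_to_unitization
        right_act_to_unitization left_act_tensor right_act_tensor
        flip: bounded_clinear_diff[OF bounded_clinear_ptensor_to_unitization])
qed

text \<open>For given \<open>F\<close> and \<open>\<epsilon>\<close>, the index \<open>j\<close> is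
  chosen first and \<open>i\<close> depends on it; the bound \<open>K'\<close> depends on
  neither.\<close>

theorem has_multiplier_bounded_approximate_diagonal_unitization:
  fixes e :: "'l \<Rightarrow> 'a::complex_banach_algebra"
    and M :: "'i \<Rightarrow> ('a, 'a) ptensor"
  assumes e: "central_bounded_approximate_identity \<Lambda> s e"
    and M: "approximate_diagonal I r M" "multiplier_bounded I M"
  shows "has_multiplier_bounded_approximate_diagonal TYPE('a unitization)"
proof -
  from e obtain C where dir_e: "directed_set \<Lambda> s" and C: "\<And>j. j \<in> \<Lambda> \<Longrightarrow> norm (e j) \<le> C"
    and central: "\<And>j a. j \<in> \<Lambda> \<Longrightarrow> e j * a = a * e j"
    and lim_e: "\<And>a. ((\<lambda>j. e j * a) \<longlongrightarrow> a) (net_filter \<Lambda> s)"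
    unfolding central_bounded_approximate_identity_def by blast
  from M obtain K0 where dir: "directed_set I r"
    and lim_comm: "\<And>a. ((\<lambda>i. a \<bullet>\<^sub>l M i - M i \<bullet>\<^sub>r a) \<longlongrightarrow> 0) (net_filter I r)"
    and lim_diag: "\<And>a. ((\<lambda>i. a * \<pi> (M i)) \<longlongrightarrow> a) (net_filter I r)"
    and bd0: "\<And>a i. i \<in> I \<Longrightarrow> norm (a \<bullet>\<^sub>l M i - M i \<bullet>\<^sub>r a) \<le> K0 * norm a \<and>
        norm (a * \<pi> (M i) - a) \<le> K0 * norm a"
    unfolding approximate_diagonal_def multiplier_bounded_def by blast
  \<comment> \<open>If A is zero, \<open>K0\<close> may be negative; the absolute value supplies the
    sign needed for monotonicity.\<close>
  define K where "K = \<bar>K0\<bar>"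
  have K_nonneg: "0 \<le> K" by (simp add: K_def)
  have bd: "norm (a \<bullet>\<^sub>l M i - M i \<bullet>\<^sub>r a) \<le> K * norm a" "norm (a * \<pi> (M i) - a) \<le> K * norm a"
    if "i \<in> I" for a i
    using bd0[OF that, of a] mult_right_mono[OF abs_ge_self[of K0] norm_ge_zero[of a]]
    by (auto simp: K_def)
  obtain j0 where "j0 \<in> \<Lambda>" using dir_e by (auto simp: directed_set_def)
  then have C_nonneg: "0 \<le> C" using C[of j0] norm_ge_zero[of "e j0"] by linarith
  define u where "u j = e j + e j - e j * e j" for j
  \<comment> \<open>The part of the commutator that does not involve \<open>M\<close>: it can be
    made small by the choice of \<open>j\<close> alone.\<close>
  define S where "S j x = \<iota> (alg_part x - e j * alg_part x) \<otimes>\<^sub>\<pi> (1 - \<iota> (e j))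
      - (1 - \<iota> (e j)) \<otimes>\<^sub>\<pi> \<iota> (alg_part x - e j * alg_part x)" for j and x :: "'a unitization"
  have comm: "x \<bullet>\<^sub>l unitization_diagonal (e j) (M i) - unitization_diagonal (e j) (M i) \<bullet>\<^sub>r x =
      \<iota>\<^sub>2 (u j \<bullet>\<^sub>l (alg_part x \<bullet>\<^sub>l M i - M i \<bullet>\<^sub>r alg_part x)) + S j x" if "j \<in> \<Lambda>" for i j x
    unfolding S_def u_def by (rule commutator_unitization_diagonal) (rule central[OF that])
  have diag: "\<pi> (unitization_diagonal (e j) (M i)) = 1 + \<iota> (u j * \<pi> (M i) - u j)" for i j
    unfolding u_def by (rule diag_map_unitization_diagonal)
  have S_le: "norm (S j x) \<le> 2 * (1 + C) * norm (alg_part x - e j * alg_part x)" if "j \<in> \<Lambda>" for j x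
  proof -
    let ?b = "alg_part x - e j * alg_part x"
    have n1: "norm (1 - \<iota> (e j)) \<le> 1 + C"
      using norm_triangle_ineq4[of 1 "\<iota> (e j)"] C[OF that] by simp
    have "norm (S j x) \<le> norm (\<iota> ?b \<otimes>\<^sub>\<pi> (1 - \<iota> (e j))) + norm ((1 - \<iota> (e j)) \<otimes>\<^sub>\<pi> \<iota> ?b)"
      unfolding S_def by (rule norm_triangle_ineq4)
    also have "\<dots> \<le> norm ?b * norm (1 - \<iota> (e j)) + norm (1 - \<iota> (e j)) * norm ?b"
      by (intro add_mono order_trans[OF norm_tensor_le]) simp_all
    also have "\<dots> \<le> norm ?b * (1 + C) + (1 + C) * norm ?b"
      by (intro add_mono mult_left_mono mult_right_mono n1) simp_all
    finally show ?thesis by (simp add: algebra_simps)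
  qed
  have u_le: "norm (u j) \<le> 2 * C + C * C" if "j \<in> \<Lambda>" for j
  proof -
    have "norm (u j) \<le> norm (e j) + norm (e j) + norm (e j * e j)"
      unfolding u_def by (intro order_trans[OF norm_triangle_ineq4] add_right_mono norm_triangle_ineq)
    also have "norm (e j * e j) \<le> C * C"
      using C[OF that] C_nonneg by (intro order_trans[OF norm_mult_ineq] mult_mono) auto
    finally show ?thesis using C[OF that] by simp
  qed
  \<comment> \<open>The first summand comes from \<open>u_le\<close> and the bound \<open>K\<close>
    for \<open>M\<close>, the second from \<open>S_le\<close> together with
    \<open>norm (b - e b) \<le> (1 + C) * norm b\<close>.\<close>
  define K' where "K' = K * (2 * C + C * C) + 2 * (1 + C) * (1 + C)"
  show ?thesis
  proof (rule has_multiplier_bounded_approximate_diagonal_finiteI[where K = K'])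
    fix F :: "'a unitization set" and \<epsilon> :: real
    assume F: "finite F" and \<epsilon>: "0 < \<epsilon>"
    have "eventually (\<lambda>j. norm (S j x) < \<epsilon>) (net_filter \<Lambda> s)" for x
    proof -
      have "((\<lambda>j. 2 * (1 + C) * norm (alg_part x - e j * alg_part x)) \<longlongrightarrow>
          2 * (1 + C) * norm (alg_part x - alg_part x)) (net_filter \<Lambda> s)"
        by (intro tendsto_intros lim_e)
      then have "eventually (\<lambda>j. 2 * (1 + C) * norm (alg_part x - e j * alg_part x) < \<epsilon>) (net_filter \<Lambda> s)"
        using \<epsilon> by (intro order_tendstoD(2)) auto
      with eventually_mem_net_filter[OF dir_e] show ?thesis
        by eventually_elim (auto intro: order.strict_trans1[OF S_le])
    qed
    then have "eventually (\<lambda>j. \<forall>x\<in>F. norm (S j x) < \<epsilon>) (net_filter \<Lambda> s)"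
      using F by (simp add: eventually_ball_finite)
    \<comment> \<open>Finiteness of \<open>F\<close> allows one \<open>j\<close> for all its
      elements; it stays fixed while \<open>i\<close> varies.\<close>
    then obtain j where j: "j \<in> \<Lambda>" and Sj: "\<forall>x\<in>F. norm (S j x) < \<epsilon>"
      by (rule eventually_net_filterD[OF dir_e])
    let ?N = "\<lambda>i. unitization_diagonal (e j) (M i)"
    have "eventually (\<lambda>i. norm (x \<bullet>\<^sub>l ?N i - ?N i \<bullet>\<^sub>r x) < \<epsilon> \<and> norm (x * \<pi> (?N i) - x) < \<epsilon>)
        (net_filter I r)" if "x \<in> F" for x
    proof (rule eventually_conj)
      have "bounded_linear (\<lambda>m. \<iota>\<^sub>2 (u j \<bullet>\<^sub>l m))"
        using bounded_clinear_compose[OF bounded_clinear_ptensor_to_unitization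
            bounded_clinear_left_act[of "u j"]]
        by (simp add: bounded_clinear_def)
      \<comment> \<open>For fixed \<open>j\<close> the commutators tend to \<open>S j x\<close>,
        which need not vanish; the strict bound \<open>Sj\<close> passes to all late
        \<open>i\<close>.\<close>
      from tendsto_add[OF bounded_linear.tendsto_zero[OF this lim_comm[of "alg_part x"]] tendsto_const]
      have "((\<lambda>i. norm (x \<bullet>\<^sub>l ?N i - ?N i \<bullet>\<^sub>r x)) \<longlongrightarrow> norm (0 + S j x)) (net_filter I r)"
        unfolding comm[OF j] by (rule tendsto_norm)
      then show "eventually (\<lambda>i. norm (x \<bullet>\<^sub>l ?N i - ?N i \<bullet>\<^sub>r x) < \<epsilon>) (net_filter I r)"
        using Sj that by (intro order_tendstoD(2)) auto
      have "bounded_linear (\<lambda>m. x * \<iota> m)"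
        using bounded_clinear_compose[OF bounded_cbilinear_act(1)[OF bounded_cbilinear_mult, of x]
            bounded_clinear_to_unitization]
        by (simp add: bounded_clinear_def)
      \<comment> \<open>Only the limit at the one element \<open>u j\<close> enters, whatever
        \<open>x\<close> is.\<close>
      from bounded_linear.tendsto_zero[OF this LIM_zero[OF lim_diag[of "u j"]]]
      have "((\<lambda>i. norm (x * \<pi> (?N i) - x)) \<longlongrightarrow> 0) (net_filter I r)"
        unfolding diag by (intro tendsto_norm_zero) (simp add: distrib_left)
      then show "eventually (\<lambda>i. norm (x * \<pi> (?N i) - x) < \<epsilon>) (net_filter I r)"
        using \<epsilon> by (rule order_tendstoD(2))
    qed
    then have "eventually (\<lambda>i. \<forall>x\<in>F. norm (x \<bullet>\<^sub>l ?N i - ?N i \<bullet>\<^sub>r x) < \<epsilon> \<and>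
        norm (x * \<pi> (?N i) - x) < \<epsilon>) (net_filter I r)"
      using F by (simp add: eventually_ball_finite)
    then obtain i where i: "i \<in> I" and small: "\<forall>x\<in>F. norm (x \<bullet>\<^sub>l ?N i - ?N i \<bullet>\<^sub>r x) < \<epsilon> \<and>
        norm (x * \<pi> (?N i) - x) < \<epsilon>"
      by (rule eventually_net_filterD[OF dir])
    have comm_le: "norm (x \<bullet>\<^sub>l ?N i - ?N i \<bullet>\<^sub>r x) \<le> K' * norm x" for x
    proof -
      let ?b = "alg_part x"
      have "norm (x \<bullet>\<^sub>l ?N i - ?N i \<bullet>\<^sub>r x)
          \<le> norm (\<iota>\<^sub>2 (u j \<bullet>\<^sub>l (?b \<bullet>\<^sub>l M i - M i \<bullet>\<^sub>r ?b))) + norm (S j x)"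
        unfolding comm[OF j] by (rule norm_triangle_ineq)
      also have "norm (\<iota>\<^sub>2 (u j \<bullet>\<^sub>l (?b \<bullet>\<^sub>l M i - M i \<bullet>\<^sub>r ?b)))
          \<le> norm (?b \<bullet>\<^sub>l M i - M i \<bullet>\<^sub>r ?b) * norm (u j)"
        by (rule order_trans[OF norm_ptensor_to_unitization_le norm_left_act_le])
      also have "\<dots> \<le> (K * norm ?b) * (2 * C + C * C)"
        using K_nonneg by (intro mult_mono bd i u_le j) auto
      also have "norm (S j x) \<le> 2 * (1 + C) * ((1 + C) * norm ?b)"
      proof (rule order_trans[OF S_le[OF j] mult_left_mono])
        have "norm (?b - e j * ?b) \<le> norm ?b + norm (e j) * norm ?b"
          by (rule order_trans[OF norm_triangle_ineq4 add_left_mono[OF norm_mult_ineq]])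
        also have "\<dots> \<le> norm ?b + C * norm ?b"
          by (intro add_left_mono mult_right_mono C j) simp
        finally show "norm (?b - e j * ?b) \<le> (1 + C) * norm ?b" by (simp add: algebra_simps)
      qed (use C_nonneg in simp)
      finally have "norm (x \<bullet>\<^sub>l ?N i - ?N i \<bullet>\<^sub>r x) \<le> K' * norm ?b"
        by (simp add: K'_def algebra_simps)
      also have "\<dots> \<le> K' * norm x"
        using K_nonneg C_nonneg by (intro mult_left_mono norm_alg_part_le) (simp add: K'_def)
      finally show ?thesis .
    qed
    \<comment> \<open>A norm bound on \<open>\<pi> (?N i) - 1\<close> itself, which controls the
      products with \<open>x\<close> on both sides.\<close>
    have d_le: "norm (\<iota> (u j * \<pi> (M i) - u j)) \<le> K'"
    proof -
      have "norm (\<iota> (u j * \<pi> (M i) - u j)) \<le> K * norm (u j)" using bd(2)[OF i] by simp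
      also have "\<dots> \<le> K * (2 * C + C * C)" by (intro mult_left_mono u_le j K_nonneg)
      also have "\<dots> \<le> K'" using C_nonneg by (simp add: K'_def)
      finally show ?thesis .
    qed
    have "norm (x * \<iota> (u j * \<pi> (M i) - u j)) \<le> K' * norm x"
      "norm (\<iota> (u j * \<pi> (M i) - u j) * x) \<le> K' * norm x" for x :: "'a unitization"
      using norm_mult_ineq[of x "\<iota> (u j * \<pi> (M i) - u j)"]
        norm_mult_ineq[of "\<iota> (u j * \<pi> (M i) - u j)" x] mult_right_mono[OF d_le norm_ge_zero[of x]]
      by (linarith | simp add: mult.commute)+
    then have "norm (x * \<pi> (?N i) - x) \<le> K' * norm x" "norm (\<pi> (?N i) * x - x) \<le> K' * norm x" for x
      unfolding diag by (simp_all add: distrib_left distrib_right)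
    then show "\<exists>N :: ('a unitization, 'a unitization) ptensor.
        (\<forall>a. norm (a \<bullet>\<^sub>l N - N \<bullet>\<^sub>r a) \<le> K' * norm a \<and> norm (a * \<pi> N - a) \<le> K' * norm a \<and>
           norm (\<pi> N * a - a) \<le> K' * norm a) \<and>
        (\<forall>a\<in>F. norm (a \<bullet>\<^sub>l N - N \<bullet>\<^sub>r a) < \<epsilon> \<and> norm (a * \<pi> N - a) < \<epsilon>)"
      using small comm_le by (intro exI[of _ "?N i"]) simp
  qed
qed


section \<open>Derivations\<close>

text \<open>The adjoined identity is made to act as the identity of the module; the cross terms of
  the product then match the scalar actions.\<close>

lemma banach_bimodule_unitization:
  fixes l :: "'a::complex_banach_algebra \<Rightarrow> 'x::complex_banach \<Rightarrow> 'x"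
  assumes "banach_bimodule l r"
  shows "banach_bimodule (\<lambda>a x. l (alg_part a) x + scalar_part a *\<^sub>C x)
    (\<lambda>x a. r x (alg_part a) + scalar_part a *\<^sub>C x)"
proof -
  from assms have bl: "bounded_cbilinear l" and br: "bounded_cbilinear r"
    and act: "\<And>a b x. l (a * b) x = l a (l b x)" "\<And>a b x. r x (a * b) = r (r x a) b"
      "\<And>a b x. l a (r x b) = r (l a x) b"
    by (simp_all add: banach_bimodule_def)
  interpret l: bounded_bilinear l using bl by (simp add: bounded_cbilinear_def)
  interpret r: bounded_bilinear r using br by (simp add: bounded_cbilinear_def)
  have sc: "l (c *\<^sub>C a) x = c *\<^sub>C l a x" "l a (c *\<^sub>C x) = c *\<^sub>C l a x"
    "r (c *\<^sub>C x) a = c *\<^sub>C r x a" "r x (c *\<^sub>C a) = c *\<^sub>C r x a" for c a x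
    using bl br by (auto simp: bounded_cbilinear_def)
  note lin = sc l.add_left l.add_right r.add_left r.add_right scaleC_add_left scaleC_add_right
    scaleC_scaleC
  \<comment> \<open>The vector \<open>y\<close> stands for either action of \<open>a\<close> on
    \<open>x\<close>; in \<open>K + 1\<close> the 1 accounts for the scalar part.\<close>
  have sum_le: "norm (y + c *\<^sub>C x) \<le> (norm a + norm c) * norm x * (K + 1)"
    if "norm y \<le> norm a * norm x * K" "0 \<le> K" for y x :: 'x and c and a :: 'a and K
  proof -
    have "norm (y + c *\<^sub>C x) \<le> norm a * norm x * K + norm c * norm x"
      by (rule order_trans[OF norm_triangle_ineq]) (simp add: that norm_scaleC)
    also have "\<dots> \<le> (norm a + norm c) * norm x * (K + 1)"
      using that(2) by (simp add: algebra_simps)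
    finally show ?thesis .
  qed
  obtain K where K: "0 \<le> K" "\<And>a x. norm (l a x) \<le> norm a * norm x * K"
    using l.nonneg_bounded by blast
  obtain K' where K': "0 \<le> K'" "\<And>x a. norm (r x a) \<le> norm x * norm a * K'"
    using r.nonneg_bounded by blast
  have "bounded_cbilinear (\<lambda>a x. l (alg_part a) x + scalar_part a *\<^sub>C x)"
  proof (rule bounded_cbilinear_intro[where K = "K + 1"])
    fix x and a :: "'a unitization"
    show "norm (l (alg_part a) x + scalar_part a *\<^sub>C x) \<le> norm a * norm x * (K + 1)"
      using sum_le K by (simp add: norm_unitization_def)
  qed (simp_all add: unitization_defs[where 'a = 'a] lin algebra_simps)
  moreover have "bounded_cbilinear (\<lambda>x a. r x (alg_part a) + scalar_part a *\<^sub>C x)"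
  proof (rule bounded_cbilinear_intro[where K = "K' + 1"])
    fix x and a :: "'a unitization"
    show "norm (r x (alg_part a) + scalar_part a *\<^sub>C x) \<le> norm x * norm a * (K' + 1)"
      using sum_le[of "r x (alg_part a)" "alg_part a" x K' "scalar_part a"] K'(2)[of x "alg_part a"] K'(1)
      by (simp add: norm_unitization_def mult.commute[of "norm x"])
  qed (simp_all add: unitization_defs[where 'a = 'a] lin algebra_simps)
  ultimately show ?thesis
    unfolding banach_bimodule_def
    by (simp add: times_unitization_def lin act algebra_simps)
qed

text \<open>This is the extension vanishing at 1. The cross terms in the product of the unitization
  produce the scalar terms of the Leibniz rule.\<close>

lemma derivation_unitization:
  fixes l :: "'a::complex_banach_algebra \<Rightarrow> 'x::complex_banach \<Rightarrow> 'x"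
  assumes "derivation l r D"
  shows "derivation (\<lambda>a x. l (alg_part a) x + scalar_part a *\<^sub>C x)
    (\<lambda>x a. r x (alg_part a) + scalar_part a *\<^sub>C x) (\<lambda>a. D (alg_part a))"
proof -
  from assms have D: "bounded_clinear D" "\<And>a b. D (a * b) = l a (D b) + r (D a) b"
    by (simp_all add: derivation_def)
  have "bounded_clinear (alg_part :: 'a unitization \<Rightarrow> 'a)"
    by (rule bounded_clinear_intro[of _ 1]) (simp_all add: unitization_defs)
  from bounded_clinear_compose[OF D(1) this] show ?thesis
    unfolding derivation_def
    by (simp add: times_unitization_def D bounded_clinear_add[OF D(1)]
        bounded_clinear_scaleCD[OF D(1)] algebra_simps)
qed

text \<open>\<open>T\<close> is induced by \<open>b \<otimes> c \<mapsto> b D(c)\<close>. On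
  \<open>b \<otimes> c\<close> the identity is the Leibniz rule
  \<open>D(c a) = c D(a) + D(c) a\<close> multiplied by \<open>b\<close> from the left.\<close>

lemma inner_derivation_diagonal:
  fixes l :: "'b::complex_banach_algebra \<Rightarrow> 'x::complex_banach \<Rightarrow> 'x"
  assumes X: "banach_bimodule l r" and D: "derivation l r D"
  obtains T where "bounded_clinear T"
    "\<And>N a. l a (T N) - r (T N) a = T (a \<bullet>\<^sub>l N - N \<bullet>\<^sub>r a) + l (\<pi> N) (D a)"
proof -
  from X have bl: "bounded_cbilinear l" and br: "bounded_cbilinear r"
    and act: "\<And>a b x. l (a * b) x = l a (l b x)" "\<And>a b x. r x (a * b) = r (r x a) b"
      "\<And>a b x. l a (r x b) = r (l a x) b"
    by (simp_all add: banach_bimodule_def)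
  from D have bD: "bounded_clinear D" and D_mult: "\<And>a b. D (a * b) = l a (D b) + r (D a) b"
    by (simp_all add: derivation_def)
  have bf: "bounded_cbilinear (\<lambda>a b. l a (D b))"
    using bl bD bounded_bilinear.comp[OF _ bounded_linear_ident, of l D]
    by (simp add: bounded_cbilinear_def bounded_clinear_def)
  define T where "T = ptensor_lift (\<lambda>a b. l a (D b))"
  have bT: "bounded_clinear T" and T: "\<And>a b. T (a \<otimes>\<^sub>\<pi> b) = l a (D b)"
    unfolding T_def by (simp_all add: bounded_clinear_ptensor_lift[OF bf] ptensor_lift_tensor[OF bf])
  note la = bounded_cbilinear_act(1)[OF bl] and lx = bounded_cbilinear_act(2)[OF bl]
  have ra: "bounded_clinear (\<lambda>x. r x a)" for a
    using br unfolding bounded_cbilinear_def bounded_clinear_def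
    by (auto intro: bounded_bilinear.bounded_linear_left)
  have eq: "(\<lambda>N. l a (T N) - r (T N) a) = (\<lambda>N. T (a \<bullet>\<^sub>l N - N \<bullet>\<^sub>r a) + l (\<pi> N) (D a))" for a
  proof (rule bounded_clinear_ptensor_eqI)
    show "bounded_clinear (\<lambda>N. l a (T N) - r (T N) a)"
      by (rule bounded_clinear_minus[OF bounded_clinear_compose[OF la bT]
            bounded_clinear_compose[OF ra bT]])
    show "bounded_clinear (\<lambda>N. T (a \<bullet>\<^sub>l N - N \<bullet>\<^sub>r a) + l (\<pi> N) (D a))"
      by (rule bounded_clinear_plus[OF bounded_clinear_compose[OF bT
            bounded_clinear_minus[OF bounded_clinear_left_act bounded_clinear_right_act]]
            bounded_clinear_compose[OF lx bounded_clinear_diag_map]])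
    fix b c
    show "l a (T (b \<otimes>\<^sub>\<pi> c)) - r (T (b \<otimes>\<^sub>\<pi> c)) a =
        T (a \<bullet>\<^sub>l (b \<otimes>\<^sub>\<pi> c) - (b \<otimes>\<^sub>\<pi> c) \<bullet>\<^sub>r a) + l (\<pi> (b \<otimes>\<^sub>\<pi> c)) (D a)"
      by (simp add: bounded_clinear_diff[OF bT] left_act_tensor right_act_tensor diag_map_tensor T
          act D_mult bounded_clinear_add[OF la])
  qed
  show thesis by (rule that[OF bT]) (rule fun_cong[OF eq])
qed

text \<open>The elements \<open>T (N i)\<close> implement the inner derivations. The commutator term
  tends to 0 by continuity of \<open>T\<close>, and the other term tends to \<open>D a\<close>
  because \<open>\<pi> (N i)\<close> tends to 1.\<close>

theorem boundedly_approximately_contractible_if_unitization: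
  assumes "has_multiplier_bounded_approximate_diagonal TYPE('a::complex_banach_algebra unitization)"
  shows "boundedly_approximately_contractible TYPE('a) TYPE('x::complex_banach)"
  unfolding boundedly_approximately_contractible_def
proof (intro allI impI, elim conjE)
  fix l r and D :: "'a \<Rightarrow> 'x"
  assume X: "banach_bimodule l r" and D: "derivation l r D"
  obtain I :: "('a unitization, 'a unitization) ptensor net_index set" and s
    and N :: "_ \<Rightarrow> ('a unitization, 'a unitization) ptensor" where
    dir: "directed_set I s"
    and comm: "\<And>a. ((\<lambda>i. a \<bullet>\<^sub>l N i - N i \<bullet>\<^sub>r a) \<longlongrightarrow> 0) (net_filter I s)"
    and diag: "\<And>a. ((\<lambda>i. a * \<pi> (N i)) \<longlongrightarrow> a) (net_filter I s)"
    and "multiplier_bounded I N"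
    using assms
    unfolding has_multiplier_bounded_approximate_diagonal_def approximate_diagonal_def
    by (elim exE conjE) (rule that; assumption | blast)
  then obtain K where
    bd: "\<And>a i. i \<in> I \<Longrightarrow> norm (a \<bullet>\<^sub>l N i - N i \<bullet>\<^sub>r a) \<le> K * norm a \<and>
        norm (a * \<pi> (N i) - a) \<le> K * norm a"
    unfolding multiplier_bounded_def by blast
  define L where "L = (\<lambda>a x. l (alg_part a) x + scalar_part a *\<^sub>C x)"
  define R where "R = (\<lambda>x a. r x (alg_part a) + scalar_part a *\<^sub>C x)"
  define D' where "D' = (\<lambda>a. D (alg_part a))"
  have X': "banach_bimodule L R" and "derivation L R D'"
    unfolding L_def R_def D'_def
    by (rule banach_bimodule_unitization[OF X], rule derivation_unitization[OF D])
  then obtain T where bT: "bounded_clinear T"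
    and T: "\<And>N a. L a (T N) - R (T N) a = T (a \<bullet>\<^sub>l N - N \<bullet>\<^sub>r a) + L (\<pi> N) (D' a)"
    by (rule inner_derivation_diagonal) blast
  interpret T: bounded_linear T using bT by (simp add: bounded_clinear_def)
  interpret D: bounded_linear D using D by (simp add: derivation_def bounded_clinear_def)
  interpret l: bounded_bilinear l using X by (simp add: banach_bimodule_def bounded_cbilinear_def)
  interpret L: bounded_bilinear L using X' by (simp add: banach_bimodule_def bounded_cbilinear_def)
  \<comment> \<open>Stated with the original actions, so that \<open>E i\<close> is visibly inner
    over A; \<open>\<iota> a\<close> has scalar part 0, so \<open>L\<close> and \<open>R\<close>
    give the same value.\<close>
  define E where "E i a = l a (T (N i)) - r (T (N i)) a" for i a
  have E: "E i a = T (\<iota> a \<bullet>\<^sub>l N i - N i \<bullet>\<^sub>r \<iota> a) + L (\<pi> (N i)) (D a)" for i a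
    using T[of "\<iota> a" "N i"] by (simp add: E_def L_def R_def D'_def to_unitization_def)
  have L1: "L 1 x = x" for x
    by (simp add: L_def one_unitization_def l.zero_left scaleC_one)
  have lim: "((\<lambda>i. E i a) \<longlongrightarrow> D a) (net_filter I s)" for a
  proof -
    \<comment> \<open>Taking \<open>a = 1\<close> turns the pointwise condition into norm
      convergence.\<close>
    have "((\<lambda>i. \<pi> (N i)) \<longlongrightarrow> 1) (net_filter I s)" using diag[of 1] by simp
    from tendsto_add[OF T.tendsto_zero[OF comm[of "\<iota> a"]] L.tendsto[OF this tendsto_const[of "D a"]]]
    show ?thesis by (simp add: E L1)
  qed
  obtain B where B: "\<forall>x. norm (T x) \<le> norm x * B" "0 \<le> B" using T.nonneg_bounded by auto
  obtain G where G: "\<forall>x. norm (D x) \<le> norm x * G" "0 \<le> G" using D.nonneg_bounded by auto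
  obtain H where H: "\<forall>a x. norm (L a x) \<le> norm a * norm x * H" "0 \<le> H" using L.nonneg_bounded by auto
  \<comment> \<open>\<open>K * B\<close> bounds the commutator term; in the other term
    \<open>K + 1\<close> bounds \<open>\<pi> (N i)\<close>, \<open>G\<close> bounds \<open>D\<close>
    and \<open>H\<close> the action.\<close>
  define C where "C = K * B + (K + 1) * G * H"
  have E_le: "onorm (E i) \<le> C" if i: "i \<in> I" for i
  proof (rule onorm_bound)
    \<comment> \<open>The identity has norm 1, so the bound at \<open>a = 1\<close> forces the sign;
      this uses the given index \<open>i\<close>.\<close>
    have "0 \<le> K"
      using order_trans[OF norm_ge_zero conjunct1[OF bd[OF i, of 1]]] by simp
    then show "0 \<le> C" using B(2) G(2) H(2) by (simp add: C_def)
    fix a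
    have "norm (\<pi> (N i)) \<le> norm (1 * \<pi> (N i) - 1) + norm (1 :: 'a unitization)"
      using norm_triangle_ineq[of "1 * \<pi> (N i) - 1" "1 :: 'a unitization"] by simp
    then have pi: "norm (\<pi> (N i)) \<le> K + 1" using bd[OF i, of 1] by simp
    have "norm (E i a) \<le> norm (T (\<iota> a \<bullet>\<^sub>l N i - N i \<bullet>\<^sub>r \<iota> a)) + norm (L (\<pi> (N i)) (D a))"
      unfolding E by (rule norm_triangle_ineq)
    also have "norm (T (\<iota> a \<bullet>\<^sub>l N i - N i \<bullet>\<^sub>r \<iota> a)) \<le> (K * norm a) * B"
      using bd[OF i, of "\<iota> a"]
      by (intro order_trans[OF B(1)[rule_format] mult_right_mono] B) simp
    also have "norm (L (\<pi> (N i)) (D a)) \<le> (K + 1) * (norm a * G) * H"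
      using order_trans[OF norm_ge_zero pi]
      by (intro order_trans[OF H(1)[rule_format] mult_right_mono] mult_mono pi G(1)[rule_format] H(2))
        simp_all
    finally show "norm (E i a) \<le> C * norm a" by (simp add: C_def algebra_simps)
  qed
  \<comment> \<open>The net is indexed anew by the type that the definition prescribes. Equal image
    filters preserve the pointwise limits, and every new member is some \<open>E i\<close>, which
    preserves innerness and the bound.\<close>
  from net_reindex[OF dir, of E] obtain J :: "('a \<Rightarrow> 'x) net_index set" and t
    where J: "directed_set J t" "snd ` J \<subseteq> E ` I"
      and eq: "filtermap snd (net_filter J t) = filtermap E (net_filter I s)"
    by blast
  have "((\<lambda>j. snd j a) \<longlongrightarrow> D a) (net_filter J t)" for a
    using lim[of a] arg_cong[OF eq, of "filtermap (\<lambda>f. f a)"]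
    by (simp add: filterlim_def filtermap_filtermap)
  moreover have "inner_derivation l r (snd j)" "onorm (snd j) \<le> C" if "j \<in> J" for j
  proof -
    from J(2) that obtain i where i: "i \<in> I" "snd j = E i" by auto
    show "inner_derivation l r (snd j)" unfolding inner_derivation_def i(2) E_def by blast
    show "onorm (snd j) \<le> C" using E_le i by simp
  qed
  ultimately show "\<exists>(I :: ('a \<Rightarrow> 'x) net_index set) s E. directed_set I s \<and>
      (\<forall>i\<in>I. inner_derivation l r (E i)) \<and> (\<exists>C. \<forall>i\<in>I. onorm (E i) \<le> C) \<and>
      (\<forall>a. ((\<lambda>i. E i a) \<longlongrightarrow> D a) (net_filter I s))"
    using J(1) by blast
qed

theorem proposition3p2:
  fixes e :: "'l \<Rightarrow> 'a::complex_banach_algebra"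
    and M :: "'i \<Rightarrow> ('a, 'a) ptensor"
  assumes "central_bounded_approximate_identity \<Lambda> s e"
    and "approximate_diagonal I r M" and "multiplier_bounded I M"
  shows "has_multiplier_bounded_approximate_diagonal TYPE('a unitization) \<and>
    boundedly_approximately_contractible TYPE('a) TYPE('x::complex_banach)"
  using has_multiplier_bounded_approximate_diagonal_unitization[OF assms]
    boundedly_approximately_contractible_if_unitization by blast

end
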